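(* Let $N$ be a positive integer and let $q\neq 1$ be a complex number such that $[n]_q\ne0$ for all $1\le n\le N-1$. Let $D$ be a nonempty finite skew Young diagram and let $\boldsymbol{k}=(k_{ij})_{(i,j)\in D}$ be a family of positive integers which is diagonally constant, i.e. $k_{ij}$ depends only on $i-j$. Then $$\zeta^{BZ}_{<N}(\boldsymbol{k})=\zeta^{q\flat}_{<N}(\boldsymbol{k}),$$ where $$\zeta^{BZ}_{<N}(\boldsymbol{k})=\sum_{(m_{ij})\in \mathrm{SSYT}_{<N}(D)}\ \prod_{(i,j)\in D}\frac{q^{(k_{ij}-1)m_{ij}}}{[m_{ij}]_q^{k_{ij}}}$$ and $$\zeta^{q\flat}_{<N}(\boldsymbol{k})=\sum\ \prod_{p=p_0}^{p_1}\frac{\prod(q^{\boldsymbol{n}_p^{(2)}})\cdots\prod(q^{\boldsymbol{n}_p^{(k_p)}})}{\prod([\boldsymbol{N}-\boldsymbol{n}_p^{(1)}]_q)\prod([\boldsymbol{n}_p^{(2)}]_q)\cdots\prod([\boldsymbol{n}_p^{(k_p)}]_q)},$$ the last sum running over all families of tuples $\boldsymbol{n}_p^{(l)}\in[1,N-1]^{J_p}$ ($p_0\le p\le p_1$, $1\le l\le k_p$) satisfying $\boldsymbol{n}_p^{(l)}\trianglelefteq\boldsymbol{n}_p^{(l+1)}$ for $1\le l<k_p$ and $\boldsymbol{n}_p^{(k_p)}\vartriangleleft\boldsymbol{n}_{p+1}^{(1)}$ for $p_0\le p<p_1$.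
   Context: The $q$-integer is $[n]_q=(1-q^n)/(1-q)$. Skew Young diagrams are in English notation: $(i,j)$ is the cell in row $i$ (counted downwards) and column $j$. $\mathrm{SSYT}_{<N}(D)$ is the set of semi-standard Young tableaux $(m_{ij})_{(i,j)\in D}$ on $D$ (rows weakly increasing from left to right, columns strictly increasing from top to bottom) whose entries are positive integers less than $N$. For $p\in\mathbb{Z}$ put $D_p=\{(i,j)\in D\mid i-j=p\}$ and $J_p=\{j\in\mathbb{Z}\mid (j+p,j)\in D\}$, which is a (possibly empty) interval of integers. Put $p_0=\min\{p\mid D_p\ne\emptyset\}$, $p_1=\max\{p\mid D_p\neq\emptyset\}$, and $k_p=k_{ij}$ for any $(i,j)\in D_p$ (if $D_p=\emptyset$ for some $p_0<p<p_1$, put $k_p=1$). For integers $a,b$, $[a,b]=\{x\in\mathbb{Z}\mid a\le x\le b\}$. For tuples of integers $\boldsymbol{m}=(m_j)_{j\in J}$, $\boldsymbol{n}=(n_j)_{j\in J'}$ indexed by integer intervals $J,J'$: - $\boldsymbol{m}\vartriangleleft\boldsymbol{n}$ means: $m_j<n_j$ whenever $j\in J$ and $j\in J'$, and $n_{j-1}\le m_j$ whenever $j\in J$ and $j-1\in J'$; - $\boldsymbol{m}\trianglelefteq\boldsymbol{n}$ means: $m_j\le n_j$ whenever $j\in J$ and $j\in J'$, and $n_{j-1}<m_j$ whenever $j\in J$ and $j-1\in J'$. For a tuple $\boldsymbol{n}=(n_j)_{j\in J}$: $\prod([\boldsymbol{n}]_q)=\prod_{j\in J}[n_j]_q$, $\prod([\boldsymbol{N}-\boldsymbol{n}]_q)=\prod_{j\in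 J}[N-n_j]_q$, $\prod(q^{\boldsymbol{n}})=\prod_{j\in J}q^{n_j}$; empty products are $1$, and when $k_p=1$ only the factor $1/\prod([\boldsymbol{N}-\boldsymbol{n}_p^{(1)}]_q)$ occurs. *)

theory Defs
  imports Complex_Main "HOL-Library.FuncSet"
begin

definition qint :: "complex \<Rightarrow> nat \<Rightarrow> complex" where
  "qint q n = (1 - q ^ n) / (1 - q)"

subsection \<open>Skew Young diagrams and semi-standard tableaux\<close>

definition is_partition :: "(nat \<Rightarrow> nat) \<Rightarrow> bool" where
  "is_partition lam \<longleftrightarrow> antimono lam \<and> finite {i. lam i \<noteq> 0}"

text \<open>Partitions are sequences indexed from 0, whereas rows and columns of diagrams are numbered
  from 1.  Cells are pairs (row, column) of integers, so that the difference i - j for a cell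
  can be negative.\<close>

definition skew_diagram :: "(nat \<Rightarrow> nat) \<Rightarrow> (nat \<Rightarrow> nat) \<Rightarrow> (int \<times> int) set" where
  "skew_diagram lam mu = {(int (Suc i), int j) | i j. mu i < j \<and> j \<le> lam i}"

definition is_skew_diagram :: "(int \<times> int) set \<Rightarrow> bool" where
  "is_skew_diagram D \<longleftrightarrow>
     (\<exists>lam mu. is_partition lam \<and> is_partition mu \<and> (\<forall>i. mu i \<le> lam i) \<and>
        D = skew_diagram lam mu)"

definition SSYT :: "nat \<Rightarrow> (int \<times> int) set \<Rightarrow> (int \<times> int \<Rightarrow> nat) set" where
  "SSYT N D = {m \<in> D \<rightarrow>\<^sub>E {m. 0 < m \<and> m < N}.
     (\<forall>i j j'. (i, j) \<in> D \<and> (i, j') \<in> D \<and> j < j' \<longrightarrow> m (i, j) \<le> m (i, j')) \<and>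
     (\<forall>i i' j. (i, j) \<in> D \<and> (i', j) \<in> D \<and> i < i' \<longrightarrow> m (i, j) < m (i', j))}"

subsection \<open>Diagonals\<close>

definition diag :: "(int \<times> int) set \<Rightarrow> int \<Rightarrow> (int \<times> int) set" where
  "diag D p = {(i, j). (i, j) \<in> D \<and> i - j = p}"

definition diag_cols :: "(int \<times> int) set \<Rightarrow> int \<Rightarrow> int set" where
  "diag_cols D p = {j. (j + p, j) \<in> D}"

definition pmin :: "(int \<times> int) set \<Rightarrow> int" where
  "pmin D = Min {p. diag D p \<noteq> {}}"

definition pmax :: "(int \<times> int) set \<Rightarrow> int" where
  "pmax D = Max {p. diag D p \<noteq> {}}"

definition diag_const :: "(int \<times> int) set \<Rightarrow> (int \<times> int \<Rightarrow> nat) \<Rightarrow> bool" where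
  "diag_const D k \<longleftrightarrow>
     (\<forall>i j i' j'. (i, j) \<in> D \<and> (i', j') \<in> D \<and> i - j = i' - j' \<longrightarrow> k (i, j) = k (i', j'))"

text \<open>The choice of the cell is irrelevant for a diagonally constant index.\<close>

definition kdiag :: "(int \<times> int) set \<Rightarrow> (int \<times> int \<Rightarrow> nat) \<Rightarrow> int \<Rightarrow> nat" where
  "kdiag D k p = (if diag D p = {} then 1 else k (SOME c. c \<in> diag D p))"

subsection \<open>Interlacing relations\<close>

text \<open>A tuple is a function together with its index set; the arguments are the index set and the
  function of the left tuple, followed by those of the right tuple.\<close>

definition tri_less :: "int set \<Rightarrow> (int \<Rightarrow> nat) \<Rightarrow> int set \<Rightarrow> (int \<Rightarrow> nat) \<Rightarrow> bool" where
  "tri_less J m J' n \<longleftrightarrow>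
     (\<forall>j. j \<in> J \<and> j \<in> J' \<longrightarrow> m j < n j) \<and>
     (\<forall>j. j \<in> J \<and> j - 1 \<in> J' \<longrightarrow> n (j - 1) \<le> m j)"

definition tri_leq :: "int set \<Rightarrow> (int \<Rightarrow> nat) \<Rightarrow> int set \<Rightarrow> (int \<Rightarrow> nat) \<Rightarrow> bool" where
  "tri_leq J m J' n \<longleftrightarrow>
     (\<forall>j. j \<in> J \<and> j \<in> J' \<longrightarrow> m j \<le> n j) \<and>
     (\<forall>j. j \<in> J \<and> j - 1 \<in> J' \<longrightarrow> n (j - 1) < m j)"

subsection \<open>The two sums\<close>

definition zeta_BZ ::
    "complex \<Rightarrow> nat \<Rightarrow> (int \<times> int) set \<Rightarrow> (int \<times> int \<Rightarrow> nat) \<Rightarrow> complex" where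
  "zeta_BZ q N D k =
     (\<Sum>m \<in> SSYT N D. \<Prod>c \<in> D. q ^ ((k c - 1) * m c) / qint q (m c) ^ k c)"

text \<open>The component with index j of the tuple with lower index p and upper index l
  is \<open>n p l j\<close>.\<close>

definition flat_families ::
    "nat \<Rightarrow> (int \<times> int) set \<Rightarrow> (int \<times> int \<Rightarrow> nat) \<Rightarrow> (int \<Rightarrow> nat \<Rightarrow> int \<Rightarrow> nat) set" where
  "flat_families N D k =
     {n \<in> (\<Pi>\<^sub>E p \<in> {pmin D..pmax D}. \<Pi>\<^sub>E l \<in> {1..kdiag D k p}. \<Pi>\<^sub>E j \<in> diag_cols D p. {1..N - 1}).
        (\<forall>p l. pmin D \<le> p \<and> p \<le> pmax D \<and> 1 \<le> l \<and> l < kdiag D k p \<longrightarrow>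
           tri_leq (diag_cols D p) (n p l) (diag_cols D p) (n p (l + 1))) \<and>
        (\<forall>p. pmin D \<le> p \<and> p < pmax D \<longrightarrow>
           tri_less (diag_cols D p) (n p (kdiag D k p)) (diag_cols D (p + 1)) (n (p + 1) 1))}"

text \<open>The natural-number subtraction in \<open>N - n p 1 j\<close> does not truncate, since
  the entries are at most \<open>N - 1\<close>.\<close>

definition zeta_flat ::
    "complex \<Rightarrow> nat \<Rightarrow> (int \<times> int) set \<Rightarrow> (int \<times> int \<Rightarrow> nat) \<Rightarrow> complex" where
  "zeta_flat q N D k =
     (\<Sum>n \<in> flat_families N D k. \<Prod>p \<in> {pmin D..pmax D}.
        (\<Prod>l \<in> {2..kdiag D k p}. \<Prod>j \<in> diag_cols D p. q ^ n p l j) /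
        ((\<Prod>j \<in> diag_cols D p. qint q (N - n p 1 j)) *
         (\<Prod>l \<in> {2..kdiag D k p}. \<Prod>j \<in> diag_cols D p. qint q (n p l j))))"

end

theory Submission
  imports Defs "HOL-Combinatorics.Permutations"
begin

text \<open>
  The connector \<open>C m n\<close>, the quotient of the falling \<open>q\<close>-factorials
  \<open>[n] [n - 1] \<dots> [n - m + 1]\<close> and \<open>[N - 1] [N - 2] \<dots> [N - m]\<close>, has differences in \<open>n\<close> and in \<open>m\<close>
  that are multiples of one function \<open>B m n\<close>:
  \<open>[m] B m n = C m n - C m (n - 1)\<close> and \<open>[N - n] B m n = C (m - 1) (n - 1) - C m (n - 1)\<close>,
  while \<open>q^m B m n = (q^n / [n]) C m n\<close>.  This exchanges a summation over a
  tableau entry \<open>m\<close> for summations over flat entries \<open>n\<close>.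

  For tuples, the connector is replaced by the determinant of its values.  The tuples interlacing
  a given one form a box, so by multilinearity a sum of determinants over them is the determinant of
  telescoped sums, and row or column operations turn the differences back into connectors.  The
  diagonals are transported in this way one after the other, starting with the largest \<open>i - j\<close>.
\<close>

section \<open>Determinants indexed by a finite set\<close>

text \<open>The Leibniz expansion, with rows and columns both labelled by \<open>J\<close>: the
  column set of a diagonal can then serve as index set without renumbering, and an empty diagonal
  gives the value 1.\<close>

definition sdet :: "'i set \<Rightarrow> ('i \<Rightarrow> 'i \<Rightarrow> 'a) \<Rightarrow> 'a :: comm_ring_1" where
  "sdet J F = (\<Sum>\<pi> | \<pi> permutes J. of_int (sign \<pi>) * (\<Prod>j\<in>J. F (\<pi> j) j))"

lemma sdet_cong:
  assumes "\<And>i j. i \<in> J \<Longrightarrow> j \<in> J \<Longrightarrow> F i j = G i j"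
  shows "sdet J F = sdet J G"
  unfolding sdet_def
  by (intro sum.cong refl arg_cong2[where f = "(*)"] prod.cong)
    (auto simp: assms permutes_in_image)

lemma sdet_empty [simp]: "sdet {} F = 1"
  by (simp add: sdet_def)

lemma sdet_transpose:
  assumes "finite J"
  shows "sdet J (\<lambda>i j. F j i) = sdet J F"
proof -
  have "sdet J (\<lambda>i j. F j i) =
      (\<Sum>\<pi> | \<pi> permutes J. of_int (sign (inv \<pi>)) * (\<Prod>j\<in>J. F j (inv \<pi> j)))"
    unfolding sdet_def by (rule sum_permutations_inverse)
  also have "\<dots> = sdet J F"
    unfolding sdet_def
  proof (intro sum.cong refl)
    fix \<pi> assume "\<pi> \<in> {\<pi>. \<pi> permutes J}"
    then have p: "\<pi> permutes J" by simp
    have "(\<Prod>j\<in>J. F j (inv \<pi> j)) = (\<Prod>j\<in>J. F (\<pi> j) j)"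
      by (subst prod.permute[OF p]) (simp add: permutes_inverses[OF p])
    moreover have "sign (inv \<pi>) = sign \<pi>"
      using p assms by (intro sign_inverse) (auto simp: permutation_permutes)
    ultimately show "of_int (sign (inv \<pi>)) * (\<Prod>j\<in>J. F j (inv \<pi> j)) =
        of_int (sign \<pi>) * (\<Prod>j\<in>J. F (\<pi> j) j)"
      by simp
  qed
  finally show ?thesis .
qed

lemma sdet_mult_rows:
  assumes "finite J"
  shows "sdet J (\<lambda>i j. c i * F i j) = (\<Prod>i\<in>J. c i) * sdet J F"
  unfolding sdet_def sum_distrib_left
proof (intro sum.cong refl)
  fix \<pi> assume "\<pi> \<in> {\<pi>. \<pi> permutes J}"
  then have "(\<Prod>j\<in>J. c (\<pi> j)) = (\<Prod>j\<in>J. c j)"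
    using prod.permute[of \<pi> J c] by (simp add: o_def)
  then show "of_int (sign \<pi>) * (\<Prod>j\<in>J. c (\<pi> j) * F (\<pi> j) j) =
      (\<Prod>i\<in>J. c i) * (of_int (sign \<pi>) * (\<Prod>j\<in>J. F (\<pi> j) j))"
    by (simp add: prod.distrib mult_ac)
qed

lemma sdet_mult_cols:
  "sdet J (\<lambda>i j. c j * F i j) = (\<Prod>j\<in>J. c j) * sdet J F"
  unfolding sdet_def sum_distrib_left by (simp add: prod.distrib mult_ac)

text \<open>Multilinearity over a box: in each Leibniz term the factor of column \<open>j\<close>
  depends on \<open>x\<close> only through \<open>x j\<close>, so the sum over
  \<open>PiE J X\<close> distributes over the product of the columns.\<close>

lemma sdet_sum_cols:
  assumes "finite J" "\<And>j. j \<in> J \<Longrightarrow> finite (X j)"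
  shows "(\<Sum>x\<in>PiE J X. sdet J (\<lambda>i j. F i (x j) j)) = sdet J (\<lambda>i j. \<Sum>y\<in>X j. F i y j)"
  unfolding sdet_def
  by (subst sum.swap) (simp add: sum_distrib_left[symmetric] prod_sum_PiE[OF assms])

lemma sdet_sum_rows:
  assumes "finite J" "\<And>i. i \<in> J \<Longrightarrow> finite (X i)"
  shows "(\<Sum>x\<in>PiE J X. sdet J (\<lambda>i j. F (x i) i j)) = sdet J (\<lambda>i j. \<Sum>y\<in>X i. F y i j)"
  using sdet_sum_cols[OF assms, where F = "\<lambda>i y j. F y j i"]
  by (simp add: sdet_transpose[OF assms(1), of "\<lambda>i j. F (_ i) i j"]
      sdet_transpose[OF assms(1), of "\<lambda>i j. \<Sum>y\<in>X i. F y i j"])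

text \<open>Composing each permutation with the transposition of \<open>r\<close> and
  \<open>s\<close> keeps the products and reverses the signs, so the determinant equals its own
  negative.\<close>

lemma sdet_identical_cols:
  fixes F :: "'i \<Rightarrow> 'i \<Rightarrow> 'a :: {idom, ring_char_0}"
  assumes "finite J" "r \<in> J" "s \<in> J" "r \<noteq> s" and eq: "\<And>i. F i r = F i s"
  shows "sdet J F = 0"
proof -
  let ?t = "transpose r s"
  have t: "?t permutes J" using assms by (intro permutes_swap_id)
  have F: "F i (?t j) = F i j" for i j
    using eq by (auto simp: transpose_def)
  have "sdet J F = (\<Sum>\<pi> | \<pi> permutes J. of_int (sign (\<pi> \<circ> ?t)) * (\<Prod>j\<in>J. F ((\<pi> \<circ> ?t) j) j))"
    unfolding sdet_def by (rule sum_permutations_compose_right[OF t])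
  also have "\<dots> = (\<Sum>\<pi> | \<pi> permutes J. - (of_int (sign \<pi>) * (\<Prod>j\<in>J. F (\<pi> j) j)))"
  proof (intro sum.cong refl)
    fix \<pi> assume "\<pi> \<in> {\<pi>. \<pi> permutes J}"
    then have p: "\<pi> permutes J" by simp
    have "(\<Prod>j\<in>J. F ((\<pi> \<circ> ?t) j) j) = (\<Prod>j\<in>J. F (\<pi> (?t j)) (?t j))"
      by (simp add: F)
    also have "\<dots> = (\<Prod>j\<in>J. F (\<pi> j) j)"
      using prod.permute[OF t, of "\<lambda>j. F (\<pi> j) j"] by (simp add: o_def)
    finally have *: "(\<Prod>j\<in>J. F ((\<pi> \<circ> ?t) j) j) = (\<Prod>j\<in>J. F (\<pi> j) j)" .
    show "of_int (sign (\<pi> \<circ> ?t)) * (\<Prod>j\<in>J. F ((\<pi> \<circ> ?t) j) j) =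
        - (of_int (sign \<pi>) * (\<Prod>j\<in>J. F (\<pi> j) j))"
    proof -
      have "permutation \<pi>" "permutation ?t"
        using p t assms(1) by (auto simp: permutation_permutes)
      then have "sign (\<pi> \<circ> ?t) = - sign \<pi>"
        using assms(4) by (simp add: sign_compose sign_swap_id)
      then show ?thesis using * by simp
    qed
  qed
  also have "\<dots> = - sdet J F" by (simp add: sdet_def sum_negf)
  finally show ?thesis by simp
qed

text \<open>Linearity in column \<open>r\<close> splits off a second determinant, in which columns
  \<open>r\<close> and \<open>s\<close> agree.\<close>

lemma sdet_col_minus:
  fixes F :: "'i \<Rightarrow> 'i \<Rightarrow> 'a :: {idom, ring_char_0}"
  assumes "finite J" "r \<in> J" "s \<in> J" "r \<noteq> s"
  shows "sdet J (\<lambda>i j. if j = r then F i r - F i s else F i j) = sdet J F"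
proof -
  have split: "(\<Prod>j\<in>J. if j = r then f j else g j) = f r * (\<Prod>j\<in>J - {r}. g j)" for f g :: "'i \<Rightarrow> 'a"
    using assms by (subst prod.remove[of J r]) (auto intro!: prod.cong)
  have "sdet J (\<lambda>i j. if j = r then F i r - F i s else F i j) =
      sdet J (\<lambda>i j. if j = r then F i j else F i j) -
      sdet J (\<lambda>i j. if j = r then F i s else F i j)"
    unfolding sdet_def sum_subtractf[symmetric] split
    by (intro sum.cong refl) (simp add: algebra_simps)
  also have "sdet J (\<lambda>i j. if j = r then F i s else F i j) = 0"
    using assms by (intro sdet_identical_cols[of _ r s]) auto
  finally show ?thesis by simp
qed

lemma sdet_col_diff:
  fixes F :: "int \<Rightarrow> int \<Rightarrow> 'a :: {idom, ring_char_0}"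
  shows "sdet {a..b} (\<lambda>i j. if j = a then F i j else F i j - F i (j - 1)) = sdet {a..b} F"
proof (cases "a \<le> b")
  case True
  \<comment> \<open>The columns are changed from right to left, so that column \<open>t - 1\<close>
    is still the original one when it is subtracted from column \<open>t\<close>.\<close>
  have "sdet {a..b} (\<lambda>i j. if j \<le> t then F i j else F i j - F i (j - 1)) = sdet {a..b} F"
    if "a \<le> t" "t \<le> b" for t
    using that(2,1)
  proof (induction t rule: int_le_induct)
    case base
    show ?case by (rule sdet_cong) simp
  next
    case (step t)
    let ?F = "\<lambda>i j. if j \<le> t then F i j else F i j - F i (j - 1)"
    have "sdet {a..b} (\<lambda>i j. if j \<le> t - 1 then F i j else F i j - F i (j - 1)) =
        sdet {a..b} (\<lambda>i j. if j = t then ?F i t - ?F i (t - 1) else ?F i j)"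
      by (rule sdet_cong) auto
    also have "\<dots> = sdet {a..b} ?F"
      using step by (intro sdet_col_minus[where F = ?F]) auto
    finally show ?case using step by simp
  qed
  from this[of a] True have "sdet {a..b} F =
      sdet {a..b} (\<lambda>i j. if j \<le> a then F i j else F i j - F i (j - 1))" by simp
  also have "\<dots> = sdet {a..b} (\<lambda>i j. if j = a then F i j else F i j - F i (j - 1))"
    by (rule sdet_cong) auto
  finally show ?thesis ..
qed simp

lemma sdet_row_diff:
  fixes F :: "int \<Rightarrow> int \<Rightarrow> 'a :: {idom, ring_char_0}"
  shows "sdet {a..b} (\<lambda>i j. if i = b then F i j else F i j - F (i + 1) j) = sdet {a..b} F"
proof (cases "a \<le> b")
  case True
  \<comment> \<open>Shown for columns and transposed afterwards. The changes now run from left to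
    right, so that column \<open>t + 1\<close> is still the original one when it is subtracted from
    column \<open>t\<close>.\<close>
  have "sdet {a..b} (\<lambda>i j. if j < t then F i j - F i (j + 1) else F i j) = sdet {a..b} F"
    if "a \<le> t" "t \<le> b" for t and F :: "int \<Rightarrow> int \<Rightarrow> 'a"
    using that
  proof (induction t rule: int_ge_induct)
    case base
    show ?case by (rule sdet_cong) simp
  next
    case (step t)
    let ?F = "\<lambda>i j. if j < t then F i j - F i (j + 1) else F i j"
    have "sdet {a..b} (\<lambda>i j. if j < t + 1 then F i j - F i (j + 1) else F i j) =
        sdet {a..b} (\<lambda>i j. if j = t then ?F i t - ?F i (t + 1) else ?F i j)"
      by (rule sdet_cong) auto
    also have "\<dots> = sdet {a..b} ?F"
      using step by (intro sdet_col_minus[where F = ?F]) auto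
    finally show ?case using step by simp
  qed
  from this[of b "\<lambda>i j. F j i"] True have "sdet {a..b} (\<lambda>i j. F j i) =
      sdet {a..b} (\<lambda>i j. if j < b then F j i - F (j + 1) i else F j i)" by simp
  also have "\<dots> = sdet {a..b} (\<lambda>i j. if j = b then F j i else F j i - F (j + 1) i)"
    by (rule sdet_cong) auto
  finally show ?thesis
    by (simp add: sdet_transpose[of _ F]
        sdet_transpose[of _ "\<lambda>j i. if j = b then F j i else F j i - F (j + 1) i"])
qed simp

text \<open>A permutation that moves \<open>c\<close> picks a zero from column \<open>c\<close>; the
  permutations that fix \<open>c\<close> are those of \<open>J\<close>.\<close>

lemma sdet_insert_unit_col:
  assumes "finite J" "c \<notin> J" "F c c = 1" "\<And>i. i \<in> J \<Longrightarrow> F i c = 0"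
  shows "sdet (insert c J) F = sdet J F"
proof -
  have "sdet (insert c J) F =
      (\<Sum>\<pi> | \<pi> permutes J. of_int (sign \<pi>) * (\<Prod>j\<in>insert c J. F (\<pi> j) j))"
    unfolding sdet_def
  proof (rule sum.mono_neutral_right)
    show "{\<pi>. \<pi> permutes J} \<subseteq> {\<pi>. \<pi> permutes insert c J}"
      by (auto intro: permutes_subset)
    show "\<forall>\<pi>\<in>{\<pi>. \<pi> permutes insert c J} - {\<pi>. \<pi> permutes J}.
        of_int (sign \<pi>) * (\<Prod>j\<in>insert c J. F (\<pi> j) j) = 0"
    proof
      fix \<pi> assume *: "\<pi> \<in> {\<pi>. \<pi> permutes insert c J} - {\<pi>. \<pi> permutes J}"
      then have "\<pi> c \<noteq> c"
        using permutes_superset[of \<pi> "insert c J" J] by auto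
      with * have "\<pi> c \<in> J" using permutes_in_image[of \<pi> "insert c J" c] by auto
      then show "of_int (sign \<pi>) * (\<Prod>j\<in>insert c J. F (\<pi> j) j) = 0"
        using assms by (simp add: prod.insert)
    qed
  qed (use assms in \<open>simp add: finite_permutations\<close>)
  also have "\<dots> = sdet J F"
    unfolding sdet_def using assms
    by (intro sum.cong refl) (simp add: permutes_not_in)
  finally show ?thesis .
qed

lemma sdet_insert_unit_row:
  assumes "finite J" "c \<notin> J" "F c c = 1" "\<And>j. j \<in> J \<Longrightarrow> F c j = 0"
  shows "sdet (insert c J) F = sdet J F"
  using sdet_insert_unit_col[of J c "\<lambda>i j. F j i"] assms by (simp add: sdet_transpose[of _ F])

text \<open>Both sides equal the determinant of the matrix bordered by a first row and a last column
  of ones.\<close>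

lemma sdet_row_diff_eq_col_diff:
  fixes E :: "int \<Rightarrow> int \<Rightarrow> 'a :: {idom, ring_char_0}"
  assumes "a \<le> b" and row: "\<And>j. E a j = 1" and col: "\<And>i. i \<le> b \<Longrightarrow> a \<le> i \<Longrightarrow> E i b = 1"
  shows "sdet {a..b - 1} (\<lambda>i j. E i j - E (i + 1) j) = sdet {a + 1..b} (\<lambda>i j. E i j - E i (j - 1))"
proof -
  let ?R = "\<lambda>i j. if i = b then E i j else E i j - E (i + 1) j"
  let ?C = "\<lambda>i j. if j = a then E i j else E i j - E i (j - 1)"
  have ab: "{a..b} = insert b {a..b - 1}" "{a..b} = insert a {a + 1..b}" using assms(1) by auto
  have "sdet {a..b - 1} (\<lambda>i j. E i j - E (i + 1) j) = sdet {a..b - 1} ?R"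
    by (rule sdet_cong) auto
  \<comment> \<open>Column \<open>b\<close> of \<open>?R\<close> is a unit column: the ones cancel
    in the differences, and only the entry in row \<open>b\<close> survives. Row \<open>a\<close> of
    \<open>?C\<close> is a unit row for the same reason.\<close>
  also have "\<dots> = sdet {a..b} ?R"
    unfolding ab(1) using assms by (intro sdet_insert_unit_col[symmetric]) auto
  also have "\<dots> = sdet {a..b} ?C"
    by (simp add: sdet_row_diff sdet_col_diff)
  also have "\<dots> = sdet {a + 1..b} ?C"
    unfolding ab(2) using assms by (intro sdet_insert_unit_row) auto
  also have "\<dots> = sdet {a + 1..b} (\<lambda>i j. E i j - E i (j - 1))"
    by (rule sdet_cong) auto
  finally show ?thesis .
qed

section \<open>Sums over chains\<close>

text \<open>The index type is general because chains occur at two levels: tuples within one diagonal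
  are indexed by \<open>nat\<close>, the diagonals themselves by \<open>int\<close>.\<close>

definition chains ::
    "'i :: discrete_linordered_semidom \<Rightarrow> 'i \<Rightarrow> ('i \<Rightarrow> 't set) \<Rightarrow> ('i \<Rightarrow> 't \<Rightarrow> 't \<Rightarrow> bool) \<Rightarrow> ('i \<Rightarrow> 't) set"
  where "chains a b X r = {f \<in> PiE {a..b} X. \<forall>i. a \<le> i \<and> i < b \<longrightarrow> r i (f i) (f (i + 1))}"

lemma chains_empty: "b < a \<Longrightarrow> chains a b X r = {\<lambda>_. undefined}"
  by (auto simp: chains_def)

lemma finite_chains:
  "finite {a..b} \<Longrightarrow> (\<And>i. finite (X i)) \<Longrightarrow> finite (chains a b X r)"
  unfolding chains_def by (rule finite_subset[of _ "PiE {a..b} X"]) (auto intro: finite_PiE)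

lemma chains_mem: "f \<in> chains a b X r \<Longrightarrow> a \<le> i \<Longrightarrow> i \<le> b \<Longrightarrow> f i \<in> X i"
  using PiE_mem[of f "{a..b}" X i] by (simp add: chains_def)

text \<open>For \<open>a = b\<close> the remaining chain is empty and has no first entry to be
  related to \<open>x\<close>, hence the guard \<open>a < b\<close>.\<close>

lemma chains_insert:
  fixes a b :: "'i :: discrete_linordered_semidom"
  assumes "a \<le> b"
  shows "chains a b X r = (\<lambda>(x, f). f(a := x)) `
    (SIGMA x : X a. {f \<in> chains (a + 1) b X r. a < b \<longrightarrow> r a x (f (a + 1))})" (is "_ = ?g ` ?S")
proof -
  have ins: "{a..b} = insert a {a + 1..b}"
    using assms by (auto simp: less_iff_succ_less_eq[symmetric])
  have a1: "i \<noteq> a" if "a + 1 \<le> i" for i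
    using that by (auto simp: less_iff_succ_less_eq[symmetric])
  show ?thesis
  proof
    show "chains a b X r \<subseteq> ?g ` ?S"
    proof
      fix f assume f: "f \<in> chains a b X r"
      define x g where "x = f a" and "g = f(a := undefined)"
      have "f \<in> PiE (insert a {a + 1..b}) X" using f unfolding chains_def ins by simp
      then have xg: "x \<in> X a" "g \<in> PiE {a + 1..b} X" "f = g(a := x)"
        unfolding x_def g_def using a1 by (simp_all add: PiE_mem fun_upd_in_PiE)
      have r: "r i (f i) (f (i + 1))" if "a \<le> i" "i < b" for i
        using f that by (simp add: chains_def)
      have "r i (g i) (g (i + 1))" if "a + 1 \<le> i" "i < b" for i
      proof -
        have "a < i" using that by (simp add: less_iff_succ_less_eq)
        moreover have "a < i + 1" by (rule less_trans[OF \<open>a < i\<close> less_add_one])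
        ultimately have "i \<noteq> a" "i + 1 \<noteq> a" "a \<le> i" by auto
        then show ?thesis using r[of i] that xg(3) by auto
      qed
      moreover have "r a x (g (a + 1))" if "a < b"
        using r[of a] that xg(3) less_add_one[of a] by auto
      ultimately have "(x, g) \<in> ?S"
        using xg by (simp add: chains_def)
      then show "f \<in> ?g ` ?S" by (rule rev_image_eqI) (simp add: xg(3))
    qed
    show "?g ` ?S \<subseteq> chains a b X r"
    proof
      fix g assume "g \<in> ?g ` ?S"
      then obtain x f where g: "g = f(a := x)" and x: "x \<in> X a"
        and f: "f \<in> chains (a + 1) b X r" and rx: "a < b \<longrightarrow> r a x (f (a + 1))"
        by auto
      have "f(a := x) \<in> PiE {a..b} X"
        unfolding ins using x f by (intro PiE_fun_upd) (auto simp: chains_def)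
      moreover have "r i ((f(a := x)) i) ((f(a := x)) (i + 1))" if "a \<le> i" "i < b" for i
      proof (cases "i = a")
        case True
        then show ?thesis using rx that less_add_one[of a] by auto
      next
        case False
        then have "a < i" using that by simp
        moreover from this have "a < i + 1" by (rule less_trans[OF _ less_add_one])
        ultimately show ?thesis
          using f that by (auto simp: chains_def less_iff_succ_less_eq[symmetric])
      qed
      ultimately show "g \<in> chains a b X r" by (simp add: chains_def g)
    qed
  qed
qed

lemma sum_chains_first:
  fixes a b :: "'i :: discrete_linordered_semidom" and w :: "'i \<Rightarrow> 't \<Rightarrow> 'c :: comm_semiring_1"
  assumes "a \<le> b" and fin: "finite {a + 1..b}" "\<And>i. finite (X i)"
  shows "(\<Sum>f\<in>chains a b X r. h (f a) * (\<Prod>i\<in>{a + 1..b}. w i (f i))) =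
    (\<Sum>x\<in>X a. h x * (\<Sum>f | f \<in> chains (a + 1) b X r \<and> (a < b \<longrightarrow> r a x (f (a + 1))).
      \<Prod>i\<in>{a + 1..b}. w i (f i)))"
proof -
  let ?C = "\<lambda>x. {f \<in> chains (a + 1) b X r. a < b \<longrightarrow> r a x (f (a + 1))}"
  let ?g = "\<lambda>(x, f). f(a := x)"
  have a: "a \<notin> {a + 1..b}" by (simp add: less_iff_succ_less_eq[symmetric])
  have "inj_on ?g (X a \<times> PiE {a + 1..b} X)" by (rule inj_combinator[OF a])
  then have inj: "inj_on ?g (SIGMA x : X a. ?C x)"
    by (rule inj_on_subset) (auto simp: chains_def)
  have prod: "(\<Prod>i\<in>{a + 1..b}. w i ((f(a := x)) i)) = (\<Prod>i\<in>{a + 1..b}. w i (f i))" for f x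
    using a by (intro prod.cong) auto
  have "(\<Sum>f\<in>chains a b X r. h (f a) * (\<Prod>i\<in>{a + 1..b}. w i (f i))) =
      (\<Sum>(x, f)\<in>(SIGMA x : X a. ?C x). h x * (\<Prod>i\<in>{a + 1..b}. w i (f i)))"
    unfolding chains_insert[OF assms(1)]
    by (subst sum.reindex[OF inj]) (auto intro!: sum.cong simp: prod simp del: fun_upd_apply simp: fun_upd_same)
  also have "\<dots> = (\<Sum>x\<in>X a. \<Sum>f\<in>?C x. h x * (\<Prod>i\<in>{a + 1..b}. w i (f i)))"
    using fin by (subst sum.Sigma) (auto intro: finite_subset[OF _ finite_chains[of "a + 1" b X r]])
  finally show ?thesis by (simp add: sum_distrib_left)
qed

text \<open>The Fubini counterpart of \<open>sum_chains_first\<close>: the first entry is summed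
  innermost, with the rest of the chain fixed. In this form an entry at the front can be summed out,
  or a new one attached there.\<close>

lemma sum_chains_last:
  fixes a b :: "'i :: discrete_linordered_semidom" and w :: "'i \<Rightarrow> 't \<Rightarrow> 'c :: comm_semiring_1"
  assumes "a \<le> b" and fin: "finite {a + 1..b}" "\<And>i. finite (X i)"
  shows "(\<Sum>f\<in>chains a b X r. h (f a) * (\<Prod>i\<in>{a + 1..b}. w i (f i))) =
    (\<Sum>f\<in>chains (a + 1) b X r. (\<Sum>x | x \<in> X a \<and> (a < b \<longrightarrow> r a x (f (a + 1))). h x) *
      (\<Prod>i\<in>{a + 1..b}. w i (f i)))"
proof -
  have "(\<Sum>f\<in>chains a b X r. h (f a) * (\<Prod>i\<in>{a + 1..b}. w i (f i))) =
    (\<Sum>x\<in>X a. \<Sum>f | f \<in> chains (a + 1) b X r \<and> (a < b \<longrightarrow> r a x (f (a + 1))).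
      h x * (\<Prod>i\<in>{a + 1..b}. w i (f i)))"
    by (subst sum_chains_first[OF assms]) (simp add: sum_distrib_left)
  also have "\<dots> = (\<Sum>f\<in>chains (a + 1) b X r. \<Sum>x | x \<in> X a \<and> (a < b \<longrightarrow> r a x (f (a + 1))).
      h x * (\<Prod>i\<in>{a + 1..b}. w i (f i)))"
    using fin by (intro sum.swap_restrict) (auto intro: finite_chains)
  finally show ?thesis by (simp add: sum_distrib_right)
qed

section \<open>Diagonals of a skew diagram\<close>

lemma tri_lessD:
  assumes "tri_less J m J' n"
  shows "j \<in> J \<Longrightarrow> j \<in> J' \<Longrightarrow> m j < n j" "j + 1 \<in> J \<Longrightarrow> j \<in> J' \<Longrightarrow> n j \<le> m (j + 1)"
  using assms unfolding tri_less_def by (auto dest: spec[of _ "j + 1"])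

lemma tri_leqD:
  assumes "tri_leq J m J' n"
  shows "j \<in> J \<Longrightarrow> j \<in> J' \<Longrightarrow> m j \<le> n j" "j + 1 \<in> J \<Longrightarrow> j \<in> J' \<Longrightarrow> n j < m (j + 1)"
  using assms unfolding tri_leq_def by (auto dest: spec[of _ "j + 1"])

text \<open>Models the column sets of diagonals \<open>p\<close> and \<open>p + 1\<close>. The
  bounds \<open>a \<le> b + 1\<close> and \<open>a' \<le> b' + 1\<close> make every empty interval
  end exactly one place before its start, so that the conditions on the endpoints stay meaningful
  for empty diagonals.\<close>

definition adjacent_intervals :: "int set \<Rightarrow> int set \<Rightarrow> bool" where
  "adjacent_intervals J J' \<longleftrightarrow> (\<exists>a b a' b'. J = {a..b} \<and> J' = {a'..b'} \<and>
     a \<le> b + 1 \<and> a' \<le> b' + 1 \<and> a' \<in> {a - 1, a} \<and> b' \<in> {b - 1, b})"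

lemma adjacent_intervalsD:
  assumes "adjacent_intervals J J'"
  shows "\<exists>a b. J = {a..b}" "\<exists>a b. J' = {a..b}" "finite J" "finite J'"
    "j \<in> J \<Longrightarrow> j + 1 \<in> J \<Longrightarrow> j \<in> J'" "j \<in> J' \<Longrightarrow> j + 1 \<in> J' \<Longrightarrow> j + 1 \<in> J"
  using assms by (auto simp: adjacent_intervals_def)

text \<open>Row \<open>u\<close> lies between rows \<open>i\<close> and \<open>i'\<close>:
  monotonicity of \<open>mu\<close> carries the left bound down from row \<open>i\<close>, and
  monotonicity of \<open>lam\<close> carries the right bound up from row \<open>i'\<close>.\<close>

lemma skew_diagram_convex:
  assumes "is_skew_diagram D" "(i, j) \<in> D" "(i', j') \<in> D" "i \<le> u" "u \<le> i'" "j \<le> v" "v \<le> j'"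
  shows "(u, v) \<in> D"
proof -
  obtain lam mu where anti: "antimono lam" "antimono mu" and D: "D = skew_diagram lam mu"
    using assms(1) by (auto simp: is_skew_diagram_def is_partition_def)
  obtain a b where ab: "i = int (Suc a)" "j = int b" "mu a < b" "b \<le> lam a"
    using assms(2) by (auto simp: D skew_diagram_def)
  obtain a' b' where ab': "i' = int (Suc a')" "j' = int b'" "mu a' < b'" "b' \<le> lam a'"
    using assms(3) by (auto simp: D skew_diagram_def)
  define c d where "c = nat u - 1" and "d = nat v"
  have c: "u = int (Suc c)" "a \<le> c" "c \<le> a'" and d: "v = int d" "b \<le> d" "d \<le> b'"
    using assms(4-7) ab(1,2) ab'(1,2) by (auto simp: c_def d_def)
  have "mu c < d" "d \<le> lam c"
    using antimonoD[OF anti(2) c(2)] antimonoD[OF anti(1) c(3)] ab ab' d by auto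
  then show ?thesis using c d by (auto simp: D skew_diagram_def)
qed

lemma finite_diag_cols:
  assumes "finite D"
  shows "finite (diag_cols D p)"
  using assms by (rule finite_surj[of _ _ snd]) (force simp: diag_cols_def)

lemma diag_eq_empty_iff: "diag D p = {} \<longleftrightarrow> diag_cols D p = {}"
proof -
  have "diag D p = (\<lambda>j. (j + p, j)) ` diag_cols D p"
    by (auto simp: diag_def diag_cols_def)
  then show ?thesis by simp
qed

lemma finite_convex_int_eq_atLeastAtMost:
  fixes S :: "int set"
  assumes "finite S" "S \<noteq> {}" "\<And>x y u. x \<in> S \<Longrightarrow> y \<in> S \<Longrightarrow> x \<le> u \<Longrightarrow> u \<le> y \<Longrightarrow> u \<in> S"
  shows "S = {Min S..Max S}"
proof
  show "S \<subseteq> {Min S..Max S}" using assms(1) by auto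
  show "{Min S..Max S} \<subseteq> S"
    using assms(3)[OF Min_in[OF assms(1,2)] Max_in[OF assms(1,2)]] by auto
qed

lemma adjacent_diag_cols:
  assumes skew: "is_skew_diagram D" and fin: "finite D"
  shows "adjacent_intervals (diag_cols D p) (diag_cols D (p + 1))"
proof -
  let ?J = "diag_cols D p" and ?J' = "diag_cols D (p + 1)"
  note conv = skew_diagram_convex[OF skew]
  have finJ: "finite ?J" "finite ?J'" using finite_diag_cols[OF fin] by auto
  have convJ: "u \<in> diag_cols D r" if "x \<in> diag_cols D r" "y \<in> diag_cols D r" "x \<le> u" "u \<le> y"
    for x y u r
    using that conv[of "x + r" x "y + r" y "u + r" u] by (simp add: diag_cols_def)
  \<comment> \<open>Each of the next facts finds a cell of one diagonal inside the rectangle spanned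
    by two given cells. Together they pin down the endpoints up to one place.\<close>
  have JJ: "j \<in> ?J'" if "j \<in> ?J" "j' \<in> ?J" "j < j'" for j j'
    using that conv[of "j + p" j "j' + p" j' "j + p + 1" j] by (simp add: diag_cols_def add_ac)
  have J'J': "j' \<in> ?J" if "j \<in> ?J'" "j' \<in> ?J'" "j < j'" for j j'
    using that conv[of "j + (p + 1)" j "j' + (p + 1)" j' "j' + p" j'] by (simp add: diag_cols_def)
  have JJ': "j' \<in> ?J" "j \<in> ?J'" if "j \<in> ?J" "j' \<in> ?J'" "j \<le> j'" for j j'
    using that conv[of "j + p" j "j' + (p + 1)" j' "j' + p" j']
      conv[of "j + p" j "j' + (p + 1)" j' "j + p + 1" j] by (auto simp: diag_cols_def add_ac)
  have J'J: "j - 1 \<in> ?J'" "j' + 1 \<in> ?J" if "j \<in> ?J" "j' \<in> ?J'" "j' < j" for j j'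
    using that conv[of "j' + (p + 1)" j' "j + p" j "j + p" "j - 1"]
      conv[of "j' + (p + 1)" j' "j + p" j "j' + 1 + p" "j' + 1"] by (auto simp: diag_cols_def add_ac)
  show ?thesis
  proof (cases "?J = {}")
    case True
    show ?thesis
    proof (cases "?J' = {}")
      case True
      then show ?thesis unfolding adjacent_intervals_def \<open>?J = {}\<close>
        by (intro exI[of _ 1] exI[of _ 0]) auto
    next
      case False
      then obtain c where "c \<in> ?J'" by auto
      \<comment> \<open>Two cells on diagonal \<open>p + 1\<close> would force a cell onto the empty
        diagonal \<open>p\<close>. The latter is written as \<open>{c + 1..c}\<close>, which starts
        one column after \<open>?J'\<close> and ends with it.\<close>
      then have "?J' = {c..c}"
        using J'J' True by (auto dest: linorder_neqE)
      then show ?thesis unfolding adjacent_intervals_def True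
        by (intro exI[of _ "c + 1"] exI[of _ c]) auto
    qed
  next
    case J: False
    show ?thesis
    proof (cases "?J' = {}")
      case True
      obtain c where "c \<in> ?J" using J by auto
      then have "?J = {c..c}"
        using JJ True by (auto dest: linorder_neqE)
      then show ?thesis unfolding adjacent_intervals_def True
        by (intro exI[of _ c] exI[of _ "c - 1"] exI[of _ c] exI[of _ "c - 1"]) auto
    next
      case J': False
      define a b a' b' where "a = Min ?J" "b = Max ?J" "a' = Min ?J'" "b' = Max ?J'"
      note defs = this
      have mem: "a \<in> ?J" "b \<in> ?J" "a' \<in> ?J'" "b' \<in> ?J'"
        using finJ J J' by (auto simp: defs)
      have bnd: "a \<le> j" "j \<le> b" if "j \<in> ?J" for j using that finJ by (auto simp: defs)
      have bnd': "a' \<le> j" "j \<le> b'" if "j \<in> ?J'" for j using that finJ by (auto simp: defs)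
      have "?J = {a..b}" "?J' = {a'..b'}"
        unfolding defs using finJ J J' convJ by (intro finite_convex_int_eq_atLeastAtMost; blast)+
      moreover have "a \<le> b" "a' \<le> b'" using bnd(1)[OF mem(2)] bnd'(1)[OF mem(4)] by auto
      moreover have "a' = a - 1 \<or> a' = a"
        using JJ'(2)[OF mem(1,3)] bnd'(1)[of a] J'J(2)[OF mem(1,3)] bnd(1)[of "a' + 1"] by linarith
      moreover have "b' = b - 1 \<or> b' = b"
        using JJ'(1)[OF mem(2,4)] bnd(2)[of b'] J'J(1)[OF mem(2,4)] bnd'(2)[of "b - 1"] by linarith
      ultimately have "?J = {a..b} \<and> ?J' = {a'..b'} \<and> a \<le> b + 1 \<and> a' \<le> b' + 1 \<and>
          a' \<in> {a - 1, a} \<and> b' \<in> {b - 1, b}"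
        by simp
      then show ?thesis unfolding adjacent_intervals_def by blast
    qed
  qed
qed

lemma diag_range:
  assumes "finite D" "D \<noteq> {}"
  shows "diag_cols D p \<noteq> {} \<Longrightarrow> pmin D \<le> p \<and> p \<le> pmax D"
    and "pmin D \<le> pmax D" and "diag_cols D (pmin D) \<noteq> {}"
proof -
  let ?P = "{p. diag D p \<noteq> {}}"
  have P: "?P = (\<lambda>(i, j). i - j) ` D" by (force simp: diag_def)
  have fin: "finite ?P" and ne: "?P \<noteq> {}" using assms unfolding P by auto
  show "pmin D \<le> p \<and> p \<le> pmax D" if "diag_cols D p \<noteq> {}"
    using that fin by (simp add: diag_eq_empty_iff pmin_def pmax_def)
  have "pmin D \<in> ?P" unfolding pmin_def by (rule Min_in[OF fin ne])
  then show "diag_cols D (pmin D) \<noteq> {}" "pmin D \<le> pmax D"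
    using fin by (auto simp: diag_eq_empty_iff pmax_def)
qed

lemma kdiag_eq:
  assumes "diag_const D k" "(i, j) \<in> D"
  shows "kdiag D k (i - j) = k (i, j)"
proof -
  define c where "c = (SOME c. c \<in> diag D (i - j))"
  have ne: "(i, j) \<in> diag D (i - j)" using assms by (simp add: diag_def)
  then have "c \<in> diag D (i - j)" unfolding c_def by (rule someI)
  then obtain i' j' where "c = (i', j')" "(i', j') \<in> D" "i' - j' = i - j"
    by (auto simp: diag_def)
  then have "k c = k (i, j)"
    using assms unfolding diag_const_def by blast
  with ne show ?thesis by (auto simp: kdiag_def c_def)
qed

lemma kdiag_pos:
  assumes "\<forall>c\<in>D. k c > 0"
  shows "1 \<le> kdiag D k p"
proof (cases "diag D p = {}")
  case False
  then have "(SOME c. c \<in> diag D p) \<in> diag D p" by (simp add: some_in_eq)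
  then have "(SOME c. c \<in> diag D p) \<in> D" by (auto simp: diag_def)
  with assms False show ?thesis by (simp add: kdiag_def Suc_le_eq)
qed (simp add: kdiag_def)

lemma prod_diagonals:
  assumes "finite D" "D \<noteq> {}"
  shows "(\<Prod>c\<in>D. f c) = (\<Prod>p\<in>{pmin D..pmax D}. \<Prod>j\<in>diag_cols D p. f (j + p, j))"
proof -
  have "(\<Prod>p\<in>{pmin D..pmax D}. \<Prod>j\<in>diag_cols D p. f (j + p, j)) =
      (\<Prod>(p, j)\<in>(SIGMA p : {pmin D..pmax D}. diag_cols D p). f (j + p, j))"
    using assms by (intro prod.Sigma) (auto simp: finite_diag_cols)
  also have "\<dots> = (\<Prod>c\<in>D. f c)"
  proof (rule prod.reindex_bij_witness[of _ "\<lambda>(i, j). (i - j, j)" "\<lambda>(p, j). (j + p, j)"])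
    fix c assume c: "c \<in> D"
    obtain i j where ij: "c = (i, j)" by (cases c)
    have "j \<in> diag_cols D (i - j)" using c ij by (simp add: diag_cols_def)
    then show "(case c of (i, j) \<Rightarrow> (i - j, j)) \<in> (SIGMA p : {pmin D..pmax D}. diag_cols D p)"
      using diag_range(1)[OF assms, of "i - j"] ij by auto
  qed (auto simp: diag_cols_def)
  finally show ?thesis ..
qed

text \<open>Extends an order between neighbouring cells to distant cells of the same row or
  column.\<close>

lemma transp_int_steps:
  fixes a b :: int
  assumes "transp R" "a < b" and step: "\<And>x. a \<le> x \<Longrightarrow> x < b \<Longrightarrow> R (f x) (f (x + 1))"
  shows "R (f a) (f b)"
proof -
  have "R (f a) (f x)" if "a < x" "x \<le> b" for x
    using that
  proof (induction x rule: int_gr_induct)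
    case base
    then show ?case by (intro step) auto
  next
    case (step x)
    then have "R (f a) (f x)" "R (f x) (f (x + 1))" using assms(3)[of x] by auto
    then show ?case using assms(1) by (blast dest: transpD)
  qed
  then show ?thesis using assms(2) by simp
qed

section \<open>The connector\<close>

lemma qint_0 [simp]: "qint q 0 = 0"
  by (simp add: qint_def)

lemma qint_diff:
  assumes "b \<le> a"
  shows "qint q a - qint q b = q ^ b * qint q (a - b)"
proof -
  have "q ^ a = q ^ b * q ^ (a - b)" using assms by (simp flip: power_add)
  then show ?thesis by (simp add: qint_def diff_divide_distrib[symmetric] algebra_simps)
qed

locale q_connector =
  fixes q :: complex and N :: nat
  assumes N_ge_2: "2 \<le> N" and qint_nonzero: "1 \<le> n \<Longrightarrow> n < N \<Longrightarrow> qint q n \<noteq> 0"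
begin

text \<open>A \<open>q\<close>-analogue of the ratio of binomial coefficients \<open>(n choose m) / ((N - 1) choose m)\<close>.
  The truncated subtraction makes it vanish for \<open>n < m\<close>.\<close>

definition conn :: "nat \<Rightarrow> nat \<Rightarrow> complex" where
  "conn m n = (\<Prod>t<m. qint q (n - t) / qint q (N - 1 - t))"

text \<open>This is the function \<open>B\<close>. The truncation of \<open>n - m\<close> is
  harmless, since \<open>conn m n\<close> vanishes for \<open>n < m\<close>.\<close>

definition dconn :: "nat \<Rightarrow> nat \<Rightarrow> complex" where
  "dconn m n = q ^ (n - m) * conn m n / qint q n"

lemma conn_0 [simp]: "conn 0 n = 1"
  by (simp add: conn_def)

lemma conn_Suc: "conn (Suc m) n = conn m n * (qint q (n - m) / qint q (N - 1 - m))"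
  by (simp add: conn_def)

lemma conn_eq_0: "n < m \<Longrightarrow> conn m n = 0"
  unfolding conn_def by (rule prod_zero) (auto intro!: bexI[of _ n])

lemma conn_top: "m < N \<Longrightarrow> conn m (N - 1) = 1"
  unfolding conn_def by (rule prod.neutral) (auto simp: qint_nonzero)

text \<open>Passing from \<open>n\<close> to \<open>Suc n\<close>, the falling factorial gains the
  factor \<open>[n + 1]\<close> at the top and loses \<open>[n + 1 - m]\<close> at the bottom. The
  cross-multiplied form avoids a division.\<close>

lemma conn_shift:
  assumes "m \<le> n"
  shows "conn m (Suc n) * qint q (Suc n - m) = conn m n * qint q (Suc n)"
  using assms
proof (induction m)
  case (Suc m)
  have "conn (Suc m) (Suc n) * qint q (Suc n - Suc m) =
      (conn m (Suc n) * qint q (Suc n - m)) * (qint q (n - m) / qint q (N - 1 - m))"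
    by (simp add: conn_Suc)
  also have "\<dots> = conn (Suc m) n * qint q (Suc n)"
    using Suc by (simp add: conn_Suc)
  finally show ?case .
qed simp

text \<open>After multiplication by \<open>[n]\<close>, \<open>conn_shift\<close> turns the
  difference into \<open>conn m n\<close> times
  \<open>[n] - [n - m] = q^(n - m) [m]\<close>.\<close>

lemma dconn_left:
  assumes "1 \<le> n" "n < N"
  shows "qint q m * dconn m n = conn m n - conn m (n - 1)"
proof -
  obtain l where n: "n = Suc l" using assms by (cases n) auto
  have nz: "qint q n \<noteq> 0" using qint_nonzero assms by auto
  consider "n < m" | "m = n" | "m \<le> l" using n by linarith
  then show ?thesis
  proof cases
    case 3
    have "qint q n * (conn m n - conn m l) = conn m n * (qint q n - qint q (n - m))"
      using conn_shift[OF 3] by (simp add: n algebra_simps)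
    also have "\<dots> = conn m n * (q ^ (n - m) * qint q m)"
      using 3 n by (simp add: qint_diff)
    finally show ?thesis using nz by (simp add: dconn_def n field_simps)
  qed (use nz n in \<open>simp_all add: dconn_def conn_eq_0\<close>)
qed

text \<open>With \<open>l = n - 1\<close>, the extra factor of \<open>conn (Suc m) l\<close> reduces
  the difference to \<open>[N - 1 - m] - [l - m] = q^(l - m) [N - n]\<close>.\<close>

lemma dconn_right:
  assumes "Suc m < N" "1 \<le> n" "n < N"
  shows "qint q (N - n) * dconn (Suc m) n = conn m (n - 1) - conn (Suc m) (n - 1)"
proof -
  obtain l where n: "n = Suc l" using assms by (cases n) auto
  have nz: "qint q n \<noteq> 0" "qint q (N - 1 - m) \<noteq> 0" using qint_nonzero assms by auto
  show ?thesis
  proof (cases "m \<le> l")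
    case True
    have 1: "conn (Suc m) n * qint q (N - 1 - m) = conn m l * qint q n"
      using conn_shift[OF True] nz by (simp add: conn_Suc n)
    have 2: "conn (Suc m) l * qint q (N - 1 - m) = conn m l * qint q (l - m)"
      using nz by (simp add: conn_Suc)
    have "(conn m l - conn (Suc m) l) * qint q (N - 1 - m) =
        conn m l * (qint q (N - 1 - m) - qint q (l - m))"
      using 2 by (simp add: algebra_simps)
    also have "\<dots> = conn m l * (q ^ (l - m) * qint q (N - n))"
      using True assms n by (simp add: qint_diff)
    also have "\<dots> = qint q (N - 1 - m) * (qint q (N - n) * dconn (Suc m) n)"
    proof -
      have "conn m l = conn (Suc m) n * qint q (N - 1 - m) / qint q n"
        using 1 nz by (simp add: field_simps)
      then show ?thesis by (simp add: dconn_def n)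
    qed
    finally show ?thesis using nz n by simp
  qed (simp add: dconn_def conn_eq_0 n)
qed

lemma dconn_power:
  "q ^ m * dconn m n = q ^ n / qint q n * conn m n"
proof (cases "m \<le> n")
  case True
  then have "q ^ n = q ^ m * q ^ (n - m)" by (simp flip: power_add)
  then show ?thesis by (simp add: dconn_def)
qed (simp add: dconn_def conn_eq_0)

text \<open>Telescopes \<open>dconn_left\<close>. The interval \<open>{lo..<hi}\<close> is the shape
  of the range that \<open>tri_less\<close> leaves to an entry of its left tuple;
  \<open>{lo<..hi}\<close> in the next lemma is the one for its right tuple.\<close>

lemma sum_dconn_left:
  assumes "lo \<le> hi" "1 \<le> lo" "hi \<le> N"
  shows "qint q m * (\<Sum>x\<in>{lo..<hi}. dconn m x) = conn m (hi - 1) - conn m (lo - 1)"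
  using assms
proof (induction hi rule: dec_induct)
  case (step hi)
  then have "qint q m * dconn m hi = conn m hi - conn m (hi - 1)"
    by (intro dconn_left) auto
  with step show ?case by (simp add: distrib_left)
qed simp

lemma sum_dconn_right:
  assumes "lo \<le> hi" "hi < N" "1 \<le> n" "n < N"
  shows "qint q (N - n) * (\<Sum>x\<in>{lo<..hi}. dconn x n) = conn lo (n - 1) - conn hi (n - 1)"
  using assms
proof (induction hi rule: dec_induct)
  case (step hi)
  then have "qint q (N - n) * dconn (Suc hi) n = conn hi (n - 1) - conn (Suc hi) (n - 1)"
    by (intro dconn_right) auto
  moreover have "{lo<..Suc hi} = insert (Suc hi) {lo<..hi}" using step by auto
  ultimately show ?case using step by (simp add: distrib_left)
qed simp

section \<open>Sums over interlacing tuples\<close>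

text \<open>Strict increase along a diagonal follows from the defining conditions of tableaux and of
  flat families alike, so it is built in from the start.\<close>

definition tuples :: "int set \<Rightarrow> (int \<Rightarrow> nat) set" where
  "tuples J = {x \<in> J \<rightarrow>\<^sub>E {1..N - 1}. \<forall>j. j \<in> J \<and> j + 1 \<in> J \<longrightarrow> x j < x (j + 1)}"

lemma tuplesD:
  assumes "x \<in> tuples J"
  shows "j \<in> J \<Longrightarrow> 1 \<le> x j" "j \<in> J \<Longrightarrow> x j < N"
    "j \<in> J \<Longrightarrow> j + 1 \<in> J \<Longrightarrow> x j < x (j + 1)"
    "j \<in> J \<Longrightarrow> j - 1 \<in> J \<Longrightarrow> x (j - 1) < x j"
  using assms N_ge_2 unfolding tuples_def
  by (fastforce dest: PiE_mem spec[of _ "j - 1"])+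

lemma tuples_empty [simp]: "tuples {} = {\<lambda>_. undefined}"
  by (auto simp: tuples_def)

lemma finite_tuples: "finite J \<Longrightarrow> finite (tuples J)"
  unfolding tuples_def by (rule finite_subset[of _ "J \<rightarrow>\<^sub>E {1..N - 1}"]) (auto intro: finite_PiE)

text \<open>The connector between a tableau diagonal \<open>m\<close> and the first flat tuple \<open>y\<close> of the next
  diagonal.  Where \<open>y\<close> has no entry it is padded by \<open>1\<close> on the left and by \<open>N\<close> on the right.\<close>

definition bridge :: "int set \<Rightarrow> (int \<Rightarrow> nat) \<Rightarrow> int set \<Rightarrow> (int \<Rightarrow> nat) \<Rightarrow> complex" where
  "bridge J m J' y = sdet J (\<lambda>i j. conn (m i) ((if j \<in> J' then y j else N) - 1) -
     conn (m i) ((if j - 1 \<in> J' then y (j - 1) else 1) - 1))"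

text \<open>With \<open>m\<close> padded by 0 and \<open>N - 1\<close> and \<open>y\<close> padded
  by 1 and \<open>N\<close>, the matrix \<open>E\<close> has ones throughout row
  \<open>a - 1\<close> and column \<open>b' + 1\<close>, so row differences and column differences
  have the same determinant. Their index sets exceed \<open>J'\<close> and \<open>J\<close> by at
  most one element, which carries a unit column or a unit row.\<close>

lemma bridge_eq:
  assumes adj: "adjacent_intervals J J'" and m: "m \<in> tuples J"
    and y: "J' \<noteq> {} \<Longrightarrow> y \<in> tuples J'"
  shows "bridge J m J' y = sdet J' (\<lambda>i j. conn (if i \<in> J then m i else 0) (y j - 1) -
     conn (if i + 1 \<in> J then m (i + 1) else N - 1) (y j - 1))"
proof -
  obtain a b a' b' where J: "J = {a..b}" "J' = {a'..b'}" "a \<le> b + 1" "a' \<le> b' + 1"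
      and a': "a' = a - 1 \<or> a' = a" and b': "b' = b - 1 \<or> b' = b"
    using adj unfolding adjacent_intervals_def by blast
  define mm where "mm i = (if i \<in> J then m i else if i < a then 0 else N - 1)" for i
  define yy where "yy j = (if j \<in> J' then y j else if j < a' then 1 else N)" for j
  define E where "E i j = conn (mm i) (yy j - 1)" for i j
  have mm: "mm i < N" "mm i = 0 \<longleftrightarrow> i < a" for i
    using tuplesD[OF m, of i] N_ge_2 J by (auto simp: mm_def)
  have yy: "j \<le> b' \<Longrightarrow> yy j < N" for j
    using tuplesD[OF y, of j] N_ge_2 J by (auto simp: yy_def)
  have row: "E (a - 1) j = 1" for j
    using mm(2)[of "a - 1"] by (simp add: E_def)
  have col: "E i (b' + 1) = 1" for i
  proof -
    have "yy (b' + 1) = N" using J by (auto simp: yy_def)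
    then show ?thesis using conn_top[OF mm(1)[of i]] by (simp add: E_def)
  qed
  have main: "sdet {a - 1..b'} (\<lambda>i j. E i j - E (i + 1) j) =
      sdet {a..b' + 1} (\<lambda>i j. E i j - E i (j - 1))"
    using sdet_row_diff_eq_col_diff[of "a - 1" "b' + 1" E] row col J a' by auto
  have left: "sdet {a - 1..b'} (\<lambda>i j. E i j - E (i + 1) j) =
      sdet J' (\<lambda>i j. E i j - E (i + 1) j)"
  proof (cases "a' = a")
    case True
    \<comment> \<open>Here \<open>y\<close> is padded by 1 at \<open>a - 1\<close>, and
      \<open>conn (mm i) 0 = 0\<close> because \<open>mm i\<close> is positive for
      \<open>a \<le> i\<close>. Column \<open>a - 1\<close> of the row differences is therefore a
      unit column.\<close>
    have 0: "E i (a - 1) = 0" if "a \<le> i" for i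
      using that True J mm(2)[of i] by (auto simp: E_def yy_def intro!: conn_eq_0)
    have "{a - 1..b'} = insert (a - 1) J'" using J True by auto
    then show ?thesis
      using sdet_insert_unit_col[of J' "a - 1" "\<lambda>i j. E i j - E (i + 1) j"] 0 row J True by auto
  qed (use a' J in simp)
  have right: "sdet {a..b' + 1} (\<lambda>i j. E i j - E i (j - 1)) =
      sdet J (\<lambda>i j. E i j - E i (j - 1))"
  proof (cases "b' = b")
    case True
    \<comment> \<open>Here \<open>mm (b + 1) = N - 1\<close> exceeds \<open>yy j - 1\<close>, so the
      connector vanishes and row \<open>b + 1\<close> of the column differences is a unit
      row.\<close>
    have 0: "E (b + 1) j = 0" if "j \<le> b" for j
      using that True J yy[of j] N_ge_2 by (auto simp: E_def mm_def intro!: conn_eq_0)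
    have "{a..b' + 1} = insert (b + 1) J" using J True by auto
    then show ?thesis
      using sdet_insert_unit_row[of J "b + 1" "\<lambda>i j. E i j - E i (j - 1)"] 0 col J True by auto
  qed (use b' J in simp)
  have "bridge J m J' y = sdet J (\<lambda>i j. E i j - E i (j - 1))"
    unfolding bridge_def E_def mm_def yy_def using J a' b' by (intro sdet_cong) auto
  also have "\<dots> = sdet J' (\<lambda>i j. E i j - E (i + 1) j)"
    using main left right by simp
  also have "\<dots> = sdet J' (\<lambda>i j. conn (if i \<in> J then m i else 0) (y j - 1) -
     conn (if i + 1 \<in> J then m (i + 1) else N - 1) (y j - 1))"
    unfolding E_def mm_def yy_def using J a' b' by (intro sdet_cong) auto
  finally show ?thesis .
qed

text \<open>The relation bounds each \<open>x j\<close> separately, and strict increase is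
  automatic: \<open>x j < y j \<le> x (j + 1)\<close>, where \<open>j\<close> lies in
  \<open>J'\<close> by \<open>sub\<close>. So \<open>x\<close> runs over a box, and telescoping in
  each column gives the entries of \<open>bridge\<close>.\<close>

lemma sum_sdet_tri_less_left:
  assumes fin: "finite J" and sub: "\<And>j. j \<in> J \<Longrightarrow> j + 1 \<in> J \<Longrightarrow> j \<in> J'"
    and y: "J' \<noteq> {} \<Longrightarrow> y \<in> tuples J'"
  shows "(\<Prod>i\<in>J. qint q (m i)) *
      (\<Sum>x | x \<in> tuples J \<and> tri_less J x J' y. sdet J (\<lambda>i j. dconn (m i) (x j))) =
    bridge J m J' y"
proof -
  let ?lo = "\<lambda>j. if j - 1 \<in> J' then y (j - 1) else 1"
  let ?hi = "\<lambda>j. if j \<in> J' then y j else N"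
  have yb: "1 \<le> y j" "y j < N" "j - 1 \<in> J' \<Longrightarrow> y (j - 1) < y j" if "j \<in> J'" for j
    using that tuplesD[OF y, of j] by auto
  have lohi: "?lo j \<le> ?hi j" "1 \<le> ?lo j" "?hi j \<le> N" for j
    using yb[of j] yb[of "j - 1"] N_ge_2 by (auto simp: less_imp_le)
  have set_eq: "{x \<in> tuples J. tri_less J x J' y} = (\<Pi>\<^sub>E j\<in>J. {?lo j..<?hi j})" (is "?A = ?B")
  proof
    show "?A \<subseteq> ?B"
    proof
      fix x assume "x \<in> ?A"
      then have x: "x \<in> tuples J" and t: "tri_less J x J' y" by auto
      have "x j \<in> {?lo j..<?hi j}" if "j \<in> J" for j
        using tuplesD(1,2)[OF x that] t that unfolding tri_less_def by auto
      then show "x \<in> ?B" using x by (auto simp: tuples_def PiE_def Pi_def)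
    qed
    show "?B \<subseteq> ?A"
    proof
      fix x assume x: "x \<in> ?B"
      have *: "?lo j \<le> x j" "x j < ?hi j" if "j \<in> J" for j
        using PiE_mem[OF x that] by auto
      have "x j < x (j + 1)" if "j \<in> J" "j + 1 \<in> J" for j
        using *(2)[OF that(1)] *(1)[OF that(2)] sub[OF that] by simp
      moreover have "x j \<in> {1..N - 1}" if "j \<in> J" for j
        using *[OF that] lohi[of j] by auto
      ultimately have "x \<in> tuples J"
        using x by (auto simp: tuples_def PiE_def Pi_def)
      moreover have "tri_less J x J' y"
        unfolding tri_less_def
      proof (intro conjI allI impI; elim conjE)
        fix j assume "j \<in> J" "j \<in> J'"
        then show "x j < y j" using *(2)[of j] by simp
      next
        fix j assume "j \<in> J" "j - 1 \<in> J'"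
        then show "y (j - 1) \<le> x j" using *(1)[of j] by simp
      qed
      ultimately show "x \<in> ?A" by simp
    qed
  qed
  have "(\<Sum>x\<in>?A. sdet J (\<lambda>i j. dconn (m i) (x j))) =
      sdet J (\<lambda>i j. \<Sum>x\<in>{?lo j..<?hi j}. dconn (m i) x)"
    unfolding set_eq using fin by (intro sdet_sum_cols) auto
  then have "(\<Prod>i\<in>J. qint q (m i)) * (\<Sum>x\<in>?A. sdet J (\<lambda>i j. dconn (m i) (x j))) =
      sdet J (\<lambda>i j. qint q (m i) * (\<Sum>x\<in>{?lo j..<?hi j}. dconn (m i) x))"
    by (simp only: sdet_mult_rows[OF fin])
  then show ?thesis
    by (simp only: sum_dconn_left[OF lohi] bridge_def)
qed

text \<open>The same argument by rows, with \<open>x j \<le> m (j + 1) < x (j + 1)\<close>.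
  Telescoping now gives the row differences over \<open>J'\<close>, which \<open>bridge_eq\<close>
  identifies with the bridge.\<close>

lemma sum_sdet_tri_less_right:
  assumes adj: "adjacent_intervals J J'"
    and sub: "\<And>j. j \<in> J' \<Longrightarrow> j + 1 \<in> J' \<Longrightarrow> j + 1 \<in> J"
    and m: "m \<in> tuples J" and y: "y \<in> tuples J'"
  shows "(\<Prod>j\<in>J'. qint q (N - y j)) *
      (\<Sum>x | x \<in> tuples J' \<and> tri_less J m J' x. sdet J' (\<lambda>i j. dconn (x i) (y j))) =
    bridge J m J' y"
proof -
  let ?lo = "\<lambda>j. if j \<in> J then m j else 0"
  let ?hi = "\<lambda>j. if j + 1 \<in> J then m (j + 1) else N - 1"
  have fin: "finite J'" using adj by (auto simp: adjacent_intervals_def)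
  have lohi: "?lo j \<le> ?hi j" "?hi j < N" for j
    using tuplesD[OF m, of j] tuplesD[OF m, of "j + 1"] N_ge_2 by auto
  have set_eq: "{x \<in> tuples J'. tri_less J m J' x} = (\<Pi>\<^sub>E j\<in>J'. {?lo j<..?hi j})" (is "?A = ?B")
  proof
    show "?A \<subseteq> ?B"
    proof
      fix x assume "x \<in> ?A"
      then have x: "x \<in> tuples J'" and t: "tri_less J m J' x" by auto
      have "x j \<in> {?lo j<..?hi j}" if "j \<in> J'" for j
        using tuplesD(1,2)[OF x that] t that N_ge_2 unfolding tri_less_def
        by (auto dest: spec[of _ "j + 1"])
      then show "x \<in> ?B" using x by (auto simp: tuples_def PiE_def Pi_def)
    qed
    show "?B \<subseteq> ?A"
    proof
      fix x assume x: "x \<in> ?B"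
      have *: "?lo j < x j" "x j \<le> ?hi j" if "j \<in> J'" for j
        using PiE_mem[OF x that] by auto
      have "x j < x (j + 1)" if "j \<in> J'" "j + 1 \<in> J'" for j
        using *(2)[OF that(1)] *(1)[OF that(2)] sub[OF that] by simp
      moreover have "x j \<in> {1..N - 1}" if "j \<in> J'" for j
        using *[OF that] lohi[of j] by auto
      ultimately have "x \<in> tuples J'"
        using x by (auto simp: tuples_def PiE_def Pi_def)
      moreover have "tri_less J m J' x"
        unfolding tri_less_def
      proof (intro conjI allI impI; elim conjE)
        fix j assume "j \<in> J" "j \<in> J'"
        then show "m j < x j" using *(1)[of j] by simp
      next
        fix j assume "j \<in> J" "j - 1 \<in> J'"
        then show "x (j - 1) \<le> m j" using *(2)[of "j - 1"] by simp
      qed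
      ultimately show "x \<in> ?A" by simp
    qed
  qed
  have "(\<Sum>x\<in>?A. sdet J' (\<lambda>i j. dconn (x i) (y j))) =
      sdet J' (\<lambda>i j. \<Sum>x\<in>{?lo i<..?hi i}. dconn x (y j))"
    unfolding set_eq using fin by (intro sdet_sum_rows) auto
  then have "(\<Prod>j\<in>J'. qint q (N - y j)) * (\<Sum>x\<in>?A. sdet J' (\<lambda>i j. dconn (x i) (y j))) =
      sdet J' (\<lambda>i j. qint q (N - y j) * (\<Sum>x\<in>{?lo i<..?hi i}. dconn x (y j)))"
    by (simp only: sdet_mult_cols)
  also have "\<dots> = sdet J' (\<lambda>i j. conn (?lo i) (y j - 1) - conn (?hi i) (y j - 1))"
    using tuplesD(1,2)[OF y] lohi by (intro sdet_cong sum_dconn_right) auto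
  also have "\<dots> = bridge J m J' y"
    using bridge_eq[OF adj m y] by simp
  finally show ?thesis .
qed

text \<open>Again a box, since \<open>x j \<le> y j < x (j + 1)\<close>. The telescoped columns are
  differences of neighbouring columns of connectors, which column operations undo.\<close>

lemma sum_sdet_tri_leq:
  assumes J: "J = {a..b}" and y: "y \<in> tuples J" and m: "\<And>i. i \<in> J \<Longrightarrow> 1 \<le> m i"
  shows "(\<Prod>i\<in>J. qint q (m i)) *
      (\<Sum>x | x \<in> tuples J \<and> tri_leq J x J y. sdet J (\<lambda>i j. dconn (m i) (x j))) =
    sdet J (\<lambda>i j. conn (m i) (y j))"
proof -
  let ?lo = "\<lambda>j. if j - 1 \<in> J then y (j - 1) + 1 else 1"
  let ?hi = "\<lambda>j. y j + 1"
  have fin: "finite J" using J by simp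
  have lohi: "?lo j \<le> ?hi j" "1 \<le> ?lo j" "?hi j \<le> N" if "j \<in> J" for j
    using tuplesD[OF y, of j] that N_ge_2 by auto
  have set_eq: "{x \<in> tuples J. tri_leq J x J y} = (\<Pi>\<^sub>E j\<in>J. {?lo j..<?hi j})" (is "?A = ?B")
  proof
    show "?A \<subseteq> ?B"
    proof
      fix x assume "x \<in> ?A"
      then have x: "x \<in> tuples J" and t: "tri_leq J x J y" by auto
      have "x j \<in> {?lo j..<?hi j}" if "j \<in> J" for j
        using tuplesD(1,2)[OF x that] t that unfolding tri_leq_def by auto
      then show "x \<in> ?B" using x by (auto simp: tuples_def PiE_def Pi_def)
    qed
    show "?B \<subseteq> ?A"
    proof
      fix x assume x: "x \<in> ?B"
      have *: "?lo j \<le> x j" "x j < ?hi j" if "j \<in> J" for j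
        using PiE_mem[OF x that] by auto
      have "x j < x (j + 1)" if "j \<in> J" "j + 1 \<in> J" for j
        using *(2)[OF that(1)] *(1)[OF that(2)] that by simp
      moreover have "x j \<in> {1..N - 1}" if "j \<in> J" for j
        using *[OF that] lohi[OF that] by auto
      ultimately have "x \<in> tuples J"
        using x by (auto simp: tuples_def PiE_def Pi_def)
      moreover have "tri_leq J x J y"
        unfolding tri_leq_def
      proof (intro conjI allI impI; elim conjE)
        fix j assume "j \<in> J" "j \<in> J"
        then show "x j \<le> y j" using *(2)[of j] by simp
      next
        fix j assume "j \<in> J" "j - 1 \<in> J"
        then show "y (j - 1) < x j" using *(1)[of j] by simp
      qed
      ultimately show "x \<in> ?A" by simp
    qed
  qed
  have "(\<Sum>x\<in>?A. sdet J (\<lambda>i j. dconn (m i) (x j))) =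
      sdet J (\<lambda>i j. \<Sum>x\<in>{?lo j..<?hi j}. dconn (m i) x)"
    unfolding set_eq using fin by (intro sdet_sum_cols) auto
  then have "(\<Prod>i\<in>J. qint q (m i)) * (\<Sum>x\<in>?A. sdet J (\<lambda>i j. dconn (m i) (x j))) =
      sdet J (\<lambda>i j. qint q (m i) * (\<Sum>x\<in>{?lo j..<?hi j}. dconn (m i) x))"
    by (simp only: sdet_mult_rows[OF fin])
  \<comment> \<open>In column \<open>a\<close> the lower end of the sum contributes
    \<open>conn (m i) 0\<close>, which is zero because \<open>m i\<close> is positive.\<close>
  also have "\<dots> = sdet J (\<lambda>i j. if j = a then conn (m i) (y j)
      else conn (m i) (y j) - conn (m i) (y (j - 1)))"
  proof (rule sdet_cong)
    fix i j assume ij: "i \<in> J" "j \<in> J"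
    have "conn (m i) 0 = 0" using m[OF ij(1)] by (intro conn_eq_0) simp
    then show "qint q (m i) * (\<Sum>x\<in>{?lo j..<?hi j}. dconn (m i) x) =
        (if j = a then conn (m i) (y j) else conn (m i) (y j) - conn (m i) (y (j - 1)))"
      unfolding sum_dconn_left[OF lohi[OF ij(2)]] using ij J by auto
  qed
  also have "\<dots> = sdet J (\<lambda>i j. conn (m i) (y j))"
    unfolding J by (rule sdet_col_diff)
  finally show ?thesis .
qed


section \<open>Transport of whole diagonals\<close>

definition diag_weight :: "nat \<Rightarrow> int set \<Rightarrow> (int \<Rightarrow> nat) \<Rightarrow> complex" where
  "diag_weight k J m = (\<Prod>j\<in>J. q ^ ((k - 1) * m j) / qint q (m j) ^ k)"

definition flat_chains :: "nat \<Rightarrow> int set \<Rightarrow> (nat \<Rightarrow> int \<Rightarrow> nat) set" where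
  "flat_chains k J = chains 1 k (\<lambda>_. tuples J) (\<lambda>_ x y. tri_leq J x J y)"

definition flat_weight :: "nat \<Rightarrow> int set \<Rightarrow> (nat \<Rightarrow> int \<Rightarrow> nat) \<Rightarrow> complex" where
  "flat_weight k J n = (\<Prod>l\<in>{2..k}. \<Prod>j\<in>J. q ^ n l j) /
     ((\<Prod>j\<in>J. qint q (N - n 1 j)) * (\<Prod>l\<in>{2..k}. \<Prod>j\<in>J. qint q (n l j)))"

text \<open>Descending induction on \<open>l\<close>. For \<open>l = k\<close> the only tuple is
  summed out into the bridge, at the cost of \<open>1 / [m i]\<close> in each row. A further tuple
  in front is summed out by \<open>sum_sdet_tri_leq\<close>, and the weight of the tuple behind it
  turns \<open>conn\<close> back into \<open>dconn\<close>; this yields one more factor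
  \<open>q ^ m i / [m i]\<close> in each row. For \<open>l = 1\<close> the tableau weight of
  \<open>m\<close> appears.\<close>

lemma sum_flat_chains_from:
  assumes adj: "adjacent_intervals J J'" and m: "m \<in> tuples J"
    and y: "J' \<noteq> {} \<Longrightarrow> y \<in> tuples J'" and l: "1 \<le> l" "l \<le> k"
  shows "(\<Sum>f | f \<in> chains l k (\<lambda>_. tuples J) (\<lambda>_ x y. tri_leq J x J y) \<and> tri_less J (f k) J' y.
      sdet J (\<lambda>i j. dconn (m i) (f l j)) * (\<Prod>h\<in>{l + 1..k}. \<Prod>j\<in>J. q ^ f h j / qint q (f h j))) =
    (\<Prod>i\<in>J. (q ^ m i / qint q (m i)) ^ (k - l) / qint q (m i)) * bridge J m J' y"
proof -
  obtain a b where J: "J = {a..b}" using adjacent_intervalsD(1)[OF adj] by blast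
  have fin: "finite J" using J by simp
  have nz: "(\<Prod>i\<in>J. qint q (m i)) \<noteq> 0"
    using fin tuplesD(1,2)[OF m] by (simp add: qint_nonzero)
  \<comment> \<open>The link to the next diagonal concerns the last tuple only; absorbing it into
    the entry set leaves a sum over chains.\<close>
  define X where "X h = (if h = k then {x \<in> tuples J. tri_less J x J' y} else tuples J)" for h
  define C where "C l = chains l k X (\<lambda>_ x y. tri_leq J x J y)" for l
  define v where "v x = (\<Prod>j\<in>J. q ^ x j / qint q (x j))" for x :: "int \<Rightarrow> nat"
  define D where "D x = sdet J (\<lambda>i j. dconn (m i) (x j))" for x :: "int \<Rightarrow> nat"
  have finX: "finite (X h)" for h
    using finite_tuples[OF fin] by (simp add: X_def)
  have C_eq: "{f \<in> chains l k (\<lambda>_. tuples J) (\<lambda>_ x y. tri_leq J x J y). tri_less J (f k) J' y} = C l"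
    if "l \<le> k" for l
    using that unfolding C_def chains_def X_def PiE_def Pi_def by (auto split: if_splits)
  have base: "(\<Prod>i\<in>J. qint q (m i)) * (\<Sum>x | x \<in> tuples J \<and> tri_less J x J' y. D x) = bridge J m J' y"
    unfolding D_def using adjacent_intervalsD[OF adj] y by (intro sum_sdet_tri_less_left) auto
  \<comment> \<open>The weight of \<open>x\<close> enters the columns, and
    \<open>dconn_power\<close> converts it into factors \<open>q ^ m i\<close> of the rows.\<close>
  have vD: "v x * sdet J (\<lambda>i j. conn (m i) (x j)) = (\<Prod>i\<in>J. q ^ m i) * D x" for x
  proof -
    have "v x * sdet J (\<lambda>i j. conn (m i) (x j)) =
        sdet J (\<lambda>i j. q ^ x j / qint q (x j) * conn (m i) (x j))"
      unfolding v_def by (rule sdet_mult_cols[symmetric])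
    also have "\<dots> = sdet J (\<lambda>i j. q ^ m i * dconn (m i) (x j))"
      by (simp only: dconn_power)
    also have "\<dots> = (\<Prod>i\<in>J. q ^ m i) * D x"
      unfolding D_def by (rule sdet_mult_rows[OF fin])
    finally show ?thesis .
  qed
  have "(\<Sum>f\<in>C l. D (f l) * (\<Prod>h\<in>{l + 1..k}. v (f h))) =
      (\<Prod>i\<in>J. (q ^ m i / qint q (m i)) ^ (k - l) / qint q (m i)) * bridge J m J' y"
    using l(2,1)
  proof (induction l rule: inc_induct)
    case base
    have "(\<Sum>f\<in>C k. D (f k) * (\<Prod>h\<in>{k + 1..k}. v (f h))) = (\<Sum>x\<in>X k. D x)"
      unfolding C_def by (subst sum_chains_last) (auto simp: finX chains_empty)
    also have "\<dots> = bridge J m J' y / (\<Prod>i\<in>J. qint q (m i))"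
      using \<open>(\<Prod>i\<in>J. qint q (m i)) * _ = _\<close> nz by (simp add: X_def field_simps)
    finally show ?case by (simp add: prod_dividef)
  next
    case (step l)
    let ?P = "\<lambda>f. \<Prod>h\<in>{l + 1 + 1..k}. v (f h)"
    have "(\<Sum>f\<in>C l. D (f l) * (\<Prod>h\<in>{l + 1..k}. v (f h))) =
        (\<Sum>f\<in>C (l + 1). (\<Sum>x | x \<in> X l \<and> (l < k \<longrightarrow> tri_leq J x J (f (l + 1))). D x) *
          (\<Prod>h\<in>{l + 1..k}. v (f h)))"
      unfolding C_def using step finX by (intro sum_chains_last) auto
    also have "\<dots> = (\<Sum>f\<in>C (l + 1). (\<Prod>i\<in>J. q ^ m i / qint q (m i)) * (D (f (l + 1)) * ?P f))"
    proof (rule sum.cong[OF refl])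
      fix f assume f: "f \<in> C (l + 1)"
      have "f (l + 1) \<in> X (l + 1)"
        using f step unfolding C_def by (intro chains_mem) auto
      then have ft: "f (l + 1) \<in> tuples J" by (auto simp: X_def split: if_splits)
      have "(\<Prod>i\<in>J. qint q (m i)) * (\<Sum>x | x \<in> tuples J \<and> tri_leq J x J (f (l + 1)). D x) =
          sdet J (\<lambda>i j. conn (m i) (f (l + 1) j))"
        unfolding D_def by (rule sum_sdet_tri_leq[OF J ft]) (use tuplesD(1)[OF m] in auto)
      then have *: "(\<Sum>x | x \<in> tuples J \<and> tri_leq J x J (f (l + 1)). D x) =
          sdet J (\<lambda>i j. conn (m i) (f (l + 1) j)) / (\<Prod>i\<in>J. qint q (m i))"
        using nz by (simp add: field_simps)
      have "{l + 1..k} = insert (l + 1) {l + 1 + 1..k}" using step by auto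
      then have P: "(\<Prod>h\<in>{l + 1..k}. v (f h)) = v (f (l + 1)) * ?P f" by simp
      have X: "{x. x \<in> X l \<and> (l < k \<longrightarrow> tri_leq J x J (f (l + 1)))} =
          {x. x \<in> tuples J \<and> tri_leq J x J (f (l + 1))}"
        using step by (auto simp: X_def)
      show "(\<Sum>x | x \<in> X l \<and> (l < k \<longrightarrow> tri_leq J x J (f (l + 1))). D x) *
          (\<Prod>h\<in>{l + 1..k}. v (f h)) =
          (\<Prod>i\<in>J. q ^ m i / qint q (m i)) * (D (f (l + 1)) * ?P f)"
        unfolding X P * using vD[of "f (l + 1)"] by (simp add: prod_dividef field_simps)
    qed
    also have "\<dots> = (\<Prod>i\<in>J. q ^ m i / qint q (m i)) *
        ((\<Prod>i\<in>J. (q ^ m i / qint q (m i)) ^ (k - (l + 1)) / qint q (m i)) * bridge J m J' y)"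
      using step.IH by (simp add: sum_distrib_left[symmetric])
    also have "k - l = Suc (k - (l + 1))" using step by simp
    then have "(\<Prod>i\<in>J. q ^ m i / qint q (m i)) *
        ((\<Prod>i\<in>J. (q ^ m i / qint q (m i)) ^ (k - (l + 1)) / qint q (m i)) * bridge J m J' y) =
        (\<Prod>i\<in>J. (q ^ m i / qint q (m i)) ^ (k - l) / qint q (m i)) * bridge J m J' y"
      by (simp only: power_Suc prod.distrib prod_dividef mult.assoc times_divide_eq_right) (simp add: prod.distrib mult_ac)
    finally show ?case .
  qed
  then show ?thesis
    unfolding C_eq[OF l(2)] D_def v_def .
qed

text \<open>Transports one diagonal from the tableau side to the flat side.\<close>

lemma sum_diag_weight_bridge:
  assumes adj0: "adjacent_intervals J0 J" and adj: "adjacent_intervals J J'"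
    and m0: "m0 \<in> tuples J0" and y: "J' \<noteq> {} \<Longrightarrow> y \<in> tuples J'" and k: "1 \<le> k"
  shows "(\<Sum>m | m \<in> tuples J \<and> tri_less J0 m0 J m. diag_weight k J m * bridge J m J' y) =
    (\<Sum>f | f \<in> flat_chains k J \<and> tri_less J (f k) J' y. bridge J0 m0 J (f 1) * flat_weight k J f)"
proof -
  have fin: "finite J" by (rule adjacent_intervalsD(3)[OF adj])
  let ?F = "{f. f \<in> flat_chains k J \<and> tri_less J (f k) J' y}"
  let ?v = "\<lambda>f. \<Prod>h\<in>{1 + 1..k}. \<Prod>j\<in>J. q ^ f h j / qint q (f h j)"
  let ?D = "\<lambda>m f. sdet J (\<lambda>i j. dconn (m i) (f (1 :: nat) j))"
  have "diag_weight k J m * bridge J m J' y = (\<Sum>f\<in>?F. ?D m f * ?v f)" if "m \<in> tuples J" for m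
  proof -
    have "diag_weight k J m = (\<Prod>i\<in>J. (q ^ m i / qint q (m i)) ^ (k - 1) / qint q (m i))"
      unfolding diag_weight_def
    proof (rule prod.cong[OF refl])
      fix i
      obtain l where "k = Suc l" using k by (cases k) auto
      then show "q ^ ((k - 1) * m i) / qint q (m i) ^ k =
          (q ^ m i / qint q (m i)) ^ (k - 1) / qint q (m i)"
        by (simp add: power_divide power_mult[symmetric] mult.commute)
    qed
    then show ?thesis
      using sum_flat_chains_from[OF adj that y, of 1 k] k by (simp add: flat_chains_def)
  qed
  \<comment> \<open>After the right bridge has been opened into flat chains, \<open>m\<close> occurs
    in the determinant alone. Summing over \<open>m\<close> for fixed \<open>f\<close> produces the
    left bridge and the factors \<open>1 / [N - f 1 j]\<close> of
    \<open>flat_weight\<close>.\<close>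
  then have "(\<Sum>m | m \<in> tuples J \<and> tri_less J0 m0 J m. diag_weight k J m * bridge J m J' y) =
      (\<Sum>f\<in>?F. (\<Sum>m | m \<in> tuples J \<and> tri_less J0 m0 J m. ?D m f) * ?v f)"
    by (simp add: sum_distrib_right) (rule sum.swap)
  also have "\<dots> = (\<Sum>f\<in>?F. bridge J0 m0 J (f 1) * flat_weight k J f)"
  proof (rule sum.cong[OF refl])
    fix f assume "f \<in> ?F"
    then have f: "f 1 \<in> tuples J" using k by (auto simp: flat_chains_def intro: chains_mem)
    have "qint q (N - f 1 j) \<noteq> 0" if "j \<in> J" for j
      using tuplesD(1,2)[OF f that] by (intro qint_nonzero) auto
    then have nz: "(\<Prod>j\<in>J. qint q (N - f 1 j)) \<noteq> 0"
      using fin by simp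
    have "(\<Prod>j\<in>J. qint q (N - f 1 j)) * (\<Sum>m | m \<in> tuples J \<and> tri_less J0 m0 J m. ?D m f) =
        bridge J0 m0 J (f 1)"
      using adjacent_intervalsD(6)[OF adj0] by (intro sum_sdet_tri_less_right adj0 m0 f) auto
    then have "(\<Sum>m | m \<in> tuples J \<and> tri_less J0 m0 J m. ?D m f) =
        bridge J0 m0 J (f 1) / (\<Prod>j\<in>J. qint q (N - f 1 j))"
      using nz by (simp add: field_simps)
    then show "(\<Sum>m | m \<in> tuples J \<and> tri_less J0 m0 J m. ?D m f) * ?v f =
        bridge J0 m0 J (f 1) * flat_weight k J f"
      by (simp add: flat_weight_def prod_dividef numeral_2_eq_2)
  qed
  finally show ?thesis .
qed

text \<open>Descending induction from \<open>p1\<close>: for a fixed tableau diagonal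
  \<open>m\<close> at \<open>p\<close>, all later diagonals have become flat and are tied to
  \<open>m\<close> by one bridge. The step to \<open>p - 1\<close> isolates diagonal
  \<open>p\<close> as an outer sum, applies the induction hypothesis to the rest, exchanges the
  sums, transports diagonal \<open>p\<close> and attaches it at the front of the flat chain.\<close>

lemma sum_diagonal_chains:
  fixes J :: "int \<Rightarrow> int set" and k :: "int \<Rightarrow> nat" and p1 :: int
  assumes adj: "\<And>p. adjacent_intervals (J p) (J (p + 1))" and last: "J (p1 + 1) = {}"
    and k: "\<And>p. 1 \<le> k p" and p: "p \<le> p1" and m: "m \<in> tuples (J p)"
  shows "(\<Sum>M | M \<in> chains (p + 1) p1 (\<lambda>p. tuples (J p)) (\<lambda>p x y. tri_less (J p) x (J (p + 1)) y) \<and>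
        (p < p1 \<longrightarrow> tri_less (J p) m (J (p + 1)) (M (p + 1))).
      \<Prod>i\<in>{p + 1..p1}. diag_weight (k i) (J i) (M i)) =
    (\<Sum>n \<in> chains (p + 1) p1 (\<lambda>p. flat_chains (k p) (J p))
        (\<lambda>p f g. tri_less (J p) (f (k p)) (J (p + 1)) (g 1)).
      bridge (J p) m (J (p + 1)) (n (p + 1) 1) * (\<Prod>i\<in>{p + 1..p1}. flat_weight (k i) (J i) (n i)))"
  using p m
proof (induction p arbitrary: m rule: int_le_induct)
  case base
  \<comment> \<open>By \<open>bridge_eq\<close> this is a determinant over the empty set
    \<open>J (p1 + 1)\<close>.\<close>
  have "bridge (J p1) m (J (p1 + 1)) y = 1" for y
    using bridge_eq[OF adj base] last by simp
  then show ?case by (simp add: chains_empty)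
next
  case (step p)
  let ?B = "\<lambda>p. chains p p1 (\<lambda>p. tuples (J p)) (\<lambda>p x y. tri_less (J p) x (J (p + 1)) y)"
  let ?F = "\<lambda>p. chains p p1 (\<lambda>p. flat_chains (k p) (J p))
    (\<lambda>p f g. tri_less (J p) (f (k p)) (J (p + 1)) (g 1))"
  let ?W = "\<lambda>i. diag_weight (k i) (J i)"
  let ?w = "\<lambda>i. flat_weight (k i) (J i)"
  let ?m = "\<lambda>x. tri_less (J (p - 1)) m (J p) x"
  have finJ: "finite (J i)" for i by (rule adjacent_intervalsD(3)[OF adj])
  have fint: "finite (tuples (J i))" for i by (rule finite_tuples[OF finJ])
  have finf: "finite (flat_chains (k i) (J i))" for i
    unfolding flat_chains_def by (rule finite_chains) (auto simp: fint)
  have adj': "adjacent_intervals (J (p - 1)) (J p)" using adj[of "p - 1"] by simp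
  have ins: "{p..p1} = insert p {p + 1..p1}" using step by auto
  \<comment> \<open>The relation to \<open>m\<close> becomes an indicator inside the weight of the
    first entry, the form that \<open>sum_chains_first\<close> accepts.\<close>
  have "(\<Sum>M | M \<in> ?B p \<and> ?m (M p). \<Prod>i\<in>{p..p1}. ?W i (M i)) =
      (\<Sum>M\<in>?B p. (if ?m (M p) then ?W p (M p) else 0) * (\<Prod>i\<in>{p + 1..p1}. ?W i (M i)))"
    unfolding ins by (intro sum.mono_neutral_cong_left) (auto intro!: finite_chains fint)
  also have "\<dots> = (\<Sum>x\<in>tuples (J p). (if ?m x then ?W p x else 0) *
      (\<Sum>f | f \<in> ?B (p + 1) \<and> (p < p1 \<longrightarrow> tri_less (J p) x (J (p + 1)) (f (p + 1))).
        \<Prod>i\<in>{p + 1..p1}. ?W i (f i)))"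
    using step fint by (intro sum_chains_first) auto
  also have "\<dots> = (\<Sum>x\<in>tuples (J p). (if ?m x then ?W p x else 0) *
      (\<Sum>n\<in>?F (p + 1). bridge (J p) x (J (p + 1)) (n (p + 1) 1) * (\<Prod>i\<in>{p + 1..p1}. ?w i (n i))))"
    using step.IH by (intro sum.cong) auto
  also have "\<dots> = (\<Sum>x | x \<in> tuples (J p) \<and> ?m x. \<Sum>n\<in>?F (p + 1).
      ?W p x * bridge (J p) x (J (p + 1)) (n (p + 1) 1) * (\<Prod>i\<in>{p + 1..p1}. ?w i (n i)))"
    by (intro sum.mono_neutral_cong_right) (auto simp: fint sum_distrib_left mult_ac)
  also have "\<dots> = (\<Sum>n\<in>?F (p + 1). (\<Sum>x | x \<in> tuples (J p) \<and> ?m x.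
      ?W p x * bridge (J p) x (J (p + 1)) (n (p + 1) 1)) * (\<Prod>i\<in>{p + 1..p1}. ?w i (n i)))"
    unfolding sum_distrib_right by (rule sum.swap)
  also have "\<dots> = (\<Sum>n\<in>?F (p + 1). (\<Sum>f | f \<in> flat_chains (k p) (J p) \<and>
        (p < p1 \<longrightarrow> tri_less (J p) (f (k p)) (J (p + 1)) (n (p + 1) 1)).
      bridge (J (p - 1)) m (J p) (f 1) * ?w p f) * (\<Prod>i\<in>{p + 1..p1}. ?w i (n i)))"
  proof (intro sum.cong refl arg_cong2[where f = "(*)"])
    fix n assume n: "n \<in> ?F (p + 1)"
    let ?y = "n (p + 1) 1"
    \<comment> \<open>For \<open>p = p1\<close> the value \<open>?y\<close> carries no information,
      but then diagonal \<open>p + 1\<close> is empty.\<close>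
    have y: "?y \<in> tuples (J (p + 1))" if "J (p + 1) \<noteq> {}"
    proof -
      have "p \<noteq> p1" using that last by auto
      then have "p + 1 \<le> p1" using step.hyps by simp
      from chains_mem[OF n order_refl this]
      have "n (p + 1) \<in> flat_chains (k (p + 1)) (J (p + 1))" .
      from chains_mem[OF this[unfolded flat_chains_def] order_refl k] show ?thesis .
    qed
    have "(\<Sum>x | x \<in> tuples (J p) \<and> ?m x. ?W p x * bridge (J p) x (J (p + 1)) ?y) =
        (\<Sum>f | f \<in> flat_chains (k p) (J p) \<and> tri_less (J p) (f (k p)) (J (p + 1)) ?y.
          bridge (J (p - 1)) m (J p) (f 1) * ?w p f)"
      using step adj adj' y k by (intro sum_diag_weight_bridge) auto
    \<comment> \<open>At \<open>p = p1\<close> the relation to the empty diagonal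
      \<open>p1 + 1\<close> is vacuous, in agreement with the guard.\<close>
    also have "{f. f \<in> flat_chains (k p) (J p) \<and> tri_less (J p) (f (k p)) (J (p + 1)) ?y} =
        {f. f \<in> flat_chains (k p) (J p) \<and>
          (p < p1 \<longrightarrow> tri_less (J p) (f (k p)) (J (p + 1)) ?y)}"
      using last step by (cases "p = p1") (auto simp: tri_less_def)
    finally show "(\<Sum>x | x \<in> tuples (J p) \<and> ?m x. ?W p x * bridge (J p) x (J (p + 1)) ?y) =
        (\<Sum>f | f \<in> flat_chains (k p) (J p) \<and>
          (p < p1 \<longrightarrow> tri_less (J p) (f (k p)) (J (p + 1)) ?y).
          bridge (J (p - 1)) m (J p) (f 1) * ?w p f)" .
  qed
  also have "\<dots> = (\<Sum>n\<in>?F p. bridge (J (p - 1)) m (J p) (n p 1) * ?w p (n p) *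
      (\<Prod>i\<in>{p + 1..p1}. ?w i (n i)))"
    using step finf by (intro sum_chains_last[symmetric]) auto
  also have "\<dots> = (\<Sum>n\<in>?F p. bridge (J (p - 1)) m (J p) (n p 1) * (\<Prod>i\<in>{p..p1}. ?w i (n i)))"
    unfolding ins by (simp add: mult.assoc)
  finally show ?case using step by simp
qed

section \<open>The two sums as sums over chains of diagonals\<close>

text \<open>A tableau is cut along its diagonals. One step to the right or upwards lowers
  \<open>i - j\<close> by one, so \<open>tri_less\<close> between successive diagonals states the
  tableau conditions for neighbouring cells.\<close>

lemma zeta_BZ_eq_sum_chains:
  assumes D: "is_skew_diagram D" "finite D" "D \<noteq> {}" and k: "diag_const D k"
  shows "zeta_BZ q N D k =
    (\<Sum>M\<in>chains (pmin D) (pmax D) (\<lambda>p. tuples (diag_cols D p))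
        (\<lambda>p x y. tri_less (diag_cols D p) x (diag_cols D (p + 1)) y).
      \<Prod>p\<in>{pmin D..pmax D}. diag_weight (kdiag D k p) (diag_cols D p) (M p))"
    (is "_ = (\<Sum>M\<in>?C. _)")
proof -
  note conv = skew_diagram_convex[OF D(1)]
  note range = diag_range(1)[OF D(2,3)]
  define to_chain where "to_chain m =
    (\<lambda>p\<in>{pmin D..pmax D}. \<lambda>j\<in>diag_cols D p. m (j + p, j))" for m :: "int \<times> int \<Rightarrow> nat"
  define to_tab where "to_tab M = (\<lambda>c\<in>D. M (fst c - snd c) (snd c))" for M :: "int \<Rightarrow> int \<Rightarrow> nat"
  have in_D: "j \<in> diag_cols D (i - j)" "pmin D \<le> i - j" "i - j \<le> pmax D" if "(i, j) \<in> D" for i j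
  proof -
    show j: "j \<in> diag_cols D (i - j)" using that by (simp add: diag_cols_def)
    show "pmin D \<le> i - j" "i - j \<le> pmax D" using range[of "i - j"] j by auto
  qed
  have chain: "to_chain m \<in> ?C" if m: "m \<in> SSYT N D" for m
  proof -
    have row: "m (i, j) \<le> m (i, j')" if "(i, j) \<in> D" "(i, j') \<in> D" "j < j'" for i j j'
      using m that by (auto simp: SSYT_def)
    have col: "m (i, j) < m (i', j)" if "(i, j) \<in> D" "(i', j) \<in> D" "i < i'" for i i' j
      using m that by (auto simp: SSYT_def)
    have val: "m c \<in> {1..N - 1}" if "c \<in> D" for c
      using m that by (fastforce simp: SSYT_def dest: PiE_mem)
    have "to_chain m p \<in> tuples (diag_cols D p)" if p: "p \<in> {pmin D..pmax D}" for p
    proof -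
      have "m (j + p, j) < m (j + 1 + p, j + 1)" if "j \<in> diag_cols D p" "j + 1 \<in> diag_cols D p" for j
      proof -
        have D: "(j + p, j) \<in> D" "(j + 1 + p, j + 1) \<in> D" using that by (auto simp: diag_cols_def)
        \<comment> \<open>The corner below the first cell and to the left of the second gives a
          strict step followed by a weak one.\<close>
        then have "(j + 1 + p, j) \<in> D" by (rule conv) auto
        then show ?thesis
          using col[OF D(1), of "j + 1 + p"] row[of "j + 1 + p" j "j + 1"] D by auto
      qed
      then show ?thesis
        using val p by (auto simp: tuples_def to_chain_def diag_cols_def)
    qed
    moreover have "tri_less (diag_cols D p) (to_chain m p) (diag_cols D (p + 1)) (to_chain m (p + 1))"
      if p: "pmin D \<le> p" "p < pmax D" for p
    proof -
      have "m (j + p, j) < m (j + (p + 1), j)"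
        if "j \<in> diag_cols D p" "j \<in> diag_cols D (p + 1)" for j
        using that by (intro col) (auto simp: diag_cols_def)
      moreover have "m (j - 1 + (p + 1), j - 1) \<le> m (j + p, j)"
        if "j \<in> diag_cols D p" "j - 1 \<in> diag_cols D (p + 1)" for j
        using that row[of "j + p" "j - 1" j] by (auto simp: diag_cols_def)
      ultimately show ?thesis using p by (auto simp: tri_less_def to_chain_def)
    qed
    ultimately show ?thesis by (auto simp: chains_def to_chain_def)
  qed
  have tab: "to_tab M \<in> SSYT N D" if M: "M \<in> ?C" for M
  proof -
    have Mt: "M (i - j) \<in> tuples (diag_cols D (i - j))" if "(i, j) \<in> D" for i j
      using in_D[OF that] by (intro chains_mem[OF M])
    have tri: "tri_less (diag_cols D p) (M p) (diag_cols D (p + 1)) (M (p + 1))"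
      if "pmin D \<le> p" "p < pmax D" for p
      using M that by (auto simp: chains_def)
    have val: "M (i - j) j \<in> {m. 0 < m \<and> m < N}" if "(i, j) \<in> D" for i j
      using tuplesD(1,2)[OF Mt[OF that] in_D(1)[OF that]] by auto
    \<comment> \<open>Convexity puts all cells between the two into \<open>D\<close>, so comparing
      neighbours is enough; likewise for columns.\<close>
    have row: "M (i - j) j \<le> M (i - j') j'" if ij: "(i, j) \<in> D" "(i, j') \<in> D" "j < j'" for i j j'
    proof (rule transp_int_steps[of "(\<le>)" j j' "\<lambda>j. M (i - j) j"])
      fix x assume x: "j \<le> x" "x < j'"
      have x1: "(i, x) \<in> D" "(i, x + 1) \<in> D" using x by (auto intro: conv[OF ij(1,2)])
      show "M (i - x) x \<le> M (i - (x + 1)) (x + 1)"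
        using tri[of "i - (x + 1)"] in_D[OF x1(1)] in_D[OF x1(2)]
        by (auto simp: tri_less_def dest: spec[of _ "x + 1"])
    qed (use ij in simp_all)
    have col: "M (i - j) j < M (i' - j) j" if ij: "(i, j) \<in> D" "(i', j) \<in> D" "i < i'" for i i' j
    proof (rule transp_int_steps[of "(<)" i i' "\<lambda>i. M (i - j) j"])
      fix x assume x: "i \<le> x" "x < i'"
      have x1: "(x, j) \<in> D" "(x + 1, j) \<in> D" using x by (auto intro: conv[OF ij(1,2)])
      have eq: "x + 1 - j = x - j + 1" by simp
      with in_D[OF x1(1)] in_D[OF x1(2)] tri[of "x - j"] show "M (x - j) j < M (x + 1 - j) j"
        unfolding eq by (simp add: tri_less_def)
    qed (use ij in simp_all)
    show ?thesis using val row col by (auto simp: SSYT_def to_tab_def)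
  qed
  have "to_tab (to_chain m) = m" if "m \<in> SSYT N D" for m
  proof
    fix c show "to_tab (to_chain m) c = m c"
      using that in_D[of "fst c" "snd c"]
      by (cases "c \<in> D") (auto simp: SSYT_def to_tab_def to_chain_def)
  qed
  moreover have "to_chain (to_tab M) = M" if M: "M \<in> ?C" for M
  proof (rule ext, rule ext)
    fix p j
    have "M p j = undefined" if "p \<in> {pmin D..pmax D}" "j \<notin> diag_cols D p"
      using chains_mem[OF M, of p] that by (auto simp: tuples_def)
    moreover have "M p = undefined" if "p \<notin> {pmin D..pmax D}"
      using M that by (auto simp: chains_def)
    ultimately show "to_chain (to_tab M) p j = M p j"
      by (auto simp: to_tab_def to_chain_def diag_cols_def)
  qed
  moreover have "(\<Prod>p\<in>{pmin D..pmax D}. diag_weight (kdiag D k p) (diag_cols D p) (to_chain m p)) =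
      (\<Prod>c\<in>D. q ^ ((k c - 1) * m c) / qint q (m c) ^ k c)" for m
    unfolding prod_diagonals[OF D(2,3)] diag_weight_def
  proof (intro prod.cong refl)
    fix p j assume pj: "p \<in> {pmin D..pmax D}" "j \<in> diag_cols D p"
    then have "kdiag D k p = k (j + p, j)"
      using kdiag_eq[OF k, of "j + p" j] by (simp add: diag_cols_def)
    then show "q ^ ((kdiag D k p - 1) * to_chain m p j) / qint q (to_chain m p j) ^ kdiag D k p =
        q ^ ((k (j + p, j) - 1) * m (j + p, j)) / qint q (m (j + p, j)) ^ k (j + p, j)"
      using pj by (simp add: to_chain_def)
  qed
  ultimately show ?thesis
    unfolding zeta_BZ_def using chain tab
    by (intro sum.reindex_bij_witness[of _ to_tab to_chain]) auto
qed

text \<open>Apart from regrouping the conditions, strict increase inside each tuple has to be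
  derived. Positions \<open>j\<close> and \<open>j + 1\<close> are separated by the entry at
  \<open>j\<close> of the following tuple, on the same diagonal or, for the last tuple, on the next
  one.\<close>

lemma flat_families_eq_chains:
  assumes D: "is_skew_diagram D" "finite D" "D \<noteq> {}" and k: "\<And>p. 1 \<le> kdiag D k p"
  shows "flat_families N D k =
    chains (pmin D) (pmax D) (\<lambda>p. flat_chains (kdiag D k p) (diag_cols D p))
      (\<lambda>p f g. tri_less (diag_cols D p) (f (kdiag D k p)) (diag_cols D (p + 1)) (g 1))"
    (is "_ = ?C")
proof
  let ?J = "diag_cols D" and ?k = "kdiag D k"
  show "?C \<subseteq> flat_families N D k"
  proof
    fix n assume n: "n \<in> ?C"
    have np: "n p \<in> flat_chains (?k p) (?J p)" if "pmin D \<le> p" "p \<le> pmax D" for p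
      using that by (rule chains_mem[OF n])
    have "n p \<in> (\<Pi>\<^sub>E l\<in>{1..?k p}. \<Pi>\<^sub>E j\<in>?J p. {1..N - 1})" if "p \<in> {pmin D..pmax D}" for p
    proof -
      have "n p l \<in> tuples (?J p)" if "l \<in> {1..?k p}" for l
        using chains_mem[of "n p" 1 "?k p" "\<lambda>_. tuples (?J p)" _ l] np[of p] that \<open>p \<in> _\<close>
        by (simp add: flat_chains_def)
      then show ?thesis using np[of p] that
        by (auto simp: flat_chains_def chains_def tuples_def PiE_def extensional_def Pi_def)
    qed
    then show "n \<in> flat_families N D k"
      using n np by (auto simp: flat_families_def flat_chains_def chains_def PiE_def Pi_def)
  qed
  show "flat_families N D k \<subseteq> ?C"
  proof
    fix n assume n: "n \<in> flat_families N D k"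
    then have n0: "n \<in> (\<Pi>\<^sub>E p\<in>{pmin D..pmax D}. \<Pi>\<^sub>E l\<in>{1..?k p}. \<Pi>\<^sub>E j\<in>?J p. {1..N - 1})"
      by (simp add: flat_families_def)
    have mem: "n p l \<in> (\<Pi>\<^sub>E j\<in>?J p. {1..N - 1})"
      if "pmin D \<le> p" "p \<le> pmax D" "1 \<le> l" "l \<le> ?k p" for p l
      using PiE_mem[OF PiE_mem[OF n0, of p], of l] that by simp
    have leq: "tri_leq (?J p) (n p l) (?J p) (n p (l + 1))"
      if "pmin D \<le> p" "p \<le> pmax D" "1 \<le> l" "l < ?k p" for p l
      using n that by (simp add: flat_families_def)
    have less: "tri_less (?J p) (n p (?k p)) (?J (p + 1)) (n (p + 1) 1)"
      if "pmin D \<le> p" "p < pmax D" for p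
      using n that by (simp add: flat_families_def)
    have tup: "n p l \<in> tuples (?J p)"
      if p: "pmin D \<le> p" "p \<le> pmax D" and l: "1 \<le> l" "l \<le> ?k p" for p l
    proof -
      have "n p l j < n p l (j + 1)" if j: "j \<in> ?J p" "j + 1 \<in> ?J p" for j
      proof (cases "l = ?k p")
        case True
        have j': "j \<in> ?J (p + 1)"
          using adjacent_intervalsD(5)[OF adjacent_diag_cols[OF D(1,2)] j] .
        \<comment> \<open>A diagonal with two consecutive cells cannot be the last, so the next
          diagonal supplies the separating entry.\<close>
        then have "?J (p + 1) \<noteq> {}" by blast
        from diag_range(1)[OF D(2,3) this] have "p < pmax D" by simp
        from tri_lessD[OF less[OF p(1) this], of j] j j' True show ?thesis by simp
      next
        case False
        with tri_leqD[OF leq[OF p l(1)], of j] l j show ?thesis by simp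
      qed
      then show ?thesis using mem[OF that] by (simp add: tuples_def)
    qed
    have "n p \<in> flat_chains (?k p) (?J p)" if "p \<in> {pmin D..pmax D}" for p
      using tup[of p] leq[of p] that n
      by (auto simp: flat_chains_def chains_def flat_families_def PiE_def Pi_def)
    then show "n \<in> ?C"
      using n less by (auto simp: chains_def flat_families_def PiE_def Pi_def)
  qed
qed

text \<open>\<open>sum_diagonal_chains\<close> is started at the auxiliary empty diagonal
  \<open>pmin D - 1\<close>: its relation to the first diagonal is vacuous, and its bridge is an
  empty determinant, hence 1.\<close>

lemma zeta_BZ_eq_zeta_flat:
  assumes D: "is_skew_diagram D" "finite D" "D \<noteq> {}"
    and k: "\<forall>c\<in>D. k c > 0" "diag_const D k"
  shows "zeta_BZ q N D k = zeta_flat q N D k"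
proof -
  let ?J = "diag_cols D" and ?k = "kdiag D k" and ?p = "pmin D - 1"
  let ?B = "chains (pmin D) (pmax D) (\<lambda>p. tuples (?J p)) (\<lambda>p x y. tri_less (?J p) x (?J (p + 1)) y)"
  have k1: "1 \<le> ?k p" for p by (rule kdiag_pos[OF k(1)])
  have adj: "adjacent_intervals (?J p) (?J (p + 1))" for p
    by (rule adjacent_diag_cols[OF D(1,2)])
  have J: "?J ?p = {}" "?J (pmax D + 1) = {}"
    using diag_range(1)[OF D(2,3), of ?p] diag_range(1)[OF D(2,3), of "pmax D + 1"] by auto
  have triv: "tri_less {} x S y" for x S y by (simp add: tri_less_def)
  have "zeta_BZ q N D k = (\<Sum>M | M \<in> ?B \<and>
      (?p < pmax D \<longrightarrow> tri_less (?J ?p) (\<lambda>_. undefined) (?J (?p + 1)) (M (?p + 1))).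
      \<Prod>p\<in>{pmin D..pmax D}. diag_weight (?k p) (?J p) (M p))"
    unfolding zeta_BZ_eq_sum_chains[OF D k(2)] J(1) by (simp add: triv)
  also have "\<dots> = (\<Sum>n\<in>flat_families N D k. bridge (?J ?p) (\<lambda>_. undefined) (?J (?p + 1)) (n (?p + 1) 1) *
      (\<Prod>p\<in>{pmin D..pmax D}. flat_weight (?k p) (?J p) (n p)))"
    using sum_diagonal_chains[of ?J "pmax D" ?k ?p "\<lambda>_. undefined", OF adj J(2) k1] J(1)
      diag_range(2)[OF D(2,3)]
    unfolding flat_families_eq_chains[OF D k1] by simp
  also have "\<dots> = zeta_flat q N D k"
    unfolding J(1) zeta_flat_def flat_weight_def by (simp add: bridge_def)
  finally show ?thesis .
qed

end

theorem theorem1p5: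
  fixes N :: nat and q :: complex
    and D :: "(int \<times> int) set" and k :: "int \<times> int \<Rightarrow> nat"
  assumes "N \<ge> 1"
    and "q \<noteq> 1"
    and "\<forall>n. 1 \<le> n \<and> n \<le> N - 1 \<longrightarrow> qint q n \<noteq> 0"
    and "is_skew_diagram D" and "finite D" and "D \<noteq> {}"
    and "\<forall>c \<in> D. k c > 0"
    and "diag_const D k"
  shows "zeta_BZ q N D k = zeta_flat q N D k"
proof (cases "N = 1")
  case True
  \<comment> \<open>For \<open>N = 1\<close> no entries are admissible, and a nonempty
    \<open>D\<close> requires at least one, so both sums are empty.\<close>
  have "SSYT N D = {}"
    using assms(6) True by (auto simp: SSYT_def PiE_def Pi_def)
  moreover have "flat_families N D k = {}"
  proof (rule equals0I)
    fix n assume n: "n \<in> flat_families N D k"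
    obtain j where j: "j \<in> diag_cols D (pmin D)" using diag_range(3)[OF assms(5,6)] by auto
    from n have "n \<in> (\<Pi>\<^sub>E p\<in>{pmin D..pmax D}. \<Pi>\<^sub>E l\<in>{1..kdiag D k p}. \<Pi>\<^sub>E j\<in>diag_cols D p. {1..N - 1})"
      by (simp add: flat_families_def)
    from PiE_mem[OF PiE_mem[OF PiE_mem[OF this, of "pmin D"], of 1], of j]
    have "n (pmin D) 1 j \<in> {1..N - 1}"
      using diag_range(2)[OF assms(5,6)] kdiag_pos[OF assms(7)] j by simp
    then show False using True by simp
  qed
  ultimately show ?thesis by (simp add: zeta_BZ_def zeta_flat_def)
next
  case False
  then interpret q_connector q N
    using assms(1,3) by unfold_locales auto
  show ?thesis using assms(4-8) by (rule zeta_BZ_eq_zeta_flat)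
qed

end
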